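(* For each Dyck path $\lambda$ of order $n$, the maps $\operatorname{DTS}(\lambda,\cdot)$ and $\operatorname{DTR}(\lambda,\cdot)$ are bijections from the set $\mathscr{L}(P_\lambda)$ of linear extensions of the chord poset of $\lambda$ to the set of cover-inclusive Dyck tilings with lower path $\lambda$.
   Context: A Dyck path of order $n$ is a lattice path from $(-n,0)$ to $(n,0)$ with steps U$=(+1,+1)$ and D$=(+1,-1)$ never going below height $0$. A chord of $\lambda$ is the horizontal segment between an up step and its matching down step; the chord poset $P_\lambda$ orders chords by nesting (a chord is above another if its span lies within the other's span). A natural labeling of $P_\lambda$ is an order-preserving bijection $L:P_\lambda\to[n]$; let $L_0$ be the natural labeling ordering chords by their left endpoints, and $\mathscr{L}(P_\lambda)=\{L_0\circ L^{-1}: L \text{ natural labeling}\}$. Equivalently, $\sigma\in\mathscr{L}(P_\lambda)$ is the standardization of $\ell_1,\dots,\ell_n$, where $\ell_i$ is the left endpoint of the chord labeled $i$. Adding a root below all chords gives an increasing plane oriented tree; such labeled trees on $n+1$ vertices are in bijection with sequences $p_1,\dots,p_n$, $0\le p_i\le 2(i-1)$, where $p_i$ is the attachment site of the vertex labeled $i$ (equivalently $p_i=\#\{j<i:\ell_j<\ell_i\}+\#\{j<i:r_j<\ell_i\}$, $r_j$ the right endpoint of chord $j$). For Dyck paths $\mu$ weakly above $\lambda$, $\lambda/\mu$ is the skew shape between them. A Dyck tile is a ribbon tile (connected skew shape without a $2\times2$ square) whose leftmost and rightmost boxes are at the same height with no box below them; a Dyck tiling tiles $\lambda/\mu$ by Dyck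 tiles. One tile covers another if some box of the first lies directly above a box of the second; the tiling is cover-inclusive if whenever a tile covers another, its horizontal extent is contained in that of the covered tile. Tiles are coordinatized by the Dyck path through the lower corners of their boxes. The spread of a path $\rho$ at column $s$ shifts points with $x\le s$ by $(-1,0)$, points with $x\ge s$ by $(+1,0)$, and points with $x=s$ also by $(0,1)$; the spread of a tiling at $s$ spreads its boundaries and all tiles. A column $s$ of a tiling $T$ of $\lambda/\mu$ is eligible if $\mu$ has an up step ending in column $s$ and the point of $\mu$ in column $s$ is not the top corner of a one-box tile; the special column is the rightmost eligible column. For a tiling $T$ of order $n$ and $-n\le s\le n$: strip-grow$(T,s)$ spreads $T$ at $s$ and then adds a one-box tile on each up step of the upper boundary from the growth site to the right boundary; ribbon-grow$(T,s)$ spreads $T$ at $s$ and, if the special column $Q$ of the spread is right of $s$, adds a ribbon of one-box tiles on top in columns strictly between $s$ and $Q$. Then $\operatorname{DTS}(p_1,\dots,p_n)=\text{strip-grow}(\operatorname{DTS}(p_1,\dots,p_{n-1}),p_n-(n-1))$ and $\operatorname{DTR}(p_1,\dots,p_n)=\text{ribbon-grow}(\operatorname{DTR}(p_1,\dots,p_{n-1}),p_n-(n-1))$, starting from the empty tiling. $\operatorname{DTS}(\lambda,\sigma)$ and $\operatorname{DTR}(\lambda,\sigma)$ denote these maps applied to the sequence $p_1,\dots,p_n$ that yields the labeled tree determined by $(\lambda,\sigma)$; the lower boundary of the resulting tiling is $\lambda$. *)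

theory Defs
  imports "HOL-Library.Disjoint_Sets" "HOL-Combinatorics.Permutations"
begin

type_synonym point = "int \<times> int"

section \<open>Dyck paths\<close>

text \<open>A lattice path is represented by the set of its lattice points. Consecutive points of a
  path with steps U and D lie in consecutive columns, so the set determines the path: it has
  an up step ending at \<open>(x, y)\<close> iff it contains both \<open>(x - 1, y - 1)\<close> and \<open>(x, y)\<close>.\<close>

definition dyck_path :: "nat \<Rightarrow> point set \<Rightarrow> bool" where
  "dyck_path n P \<longleftrightarrow>
    (\<exists>h :: int \<Rightarrow> int.
      P = {(x, h x) | x. - int n \<le> x \<and> x \<le> int n} \<and>
      h (- int n) = 0 \<and> h (int n) = 0 \<and>
      (\<forall>x. - int n \<le> x \<and> x < int n \<longrightarrow> \<bar>h (x + 1) - h x\<bar> = 1) \<and>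
      (\<forall>x. - int n \<le> x \<and> x \<le> int n \<longrightarrow> 0 \<le> h x))"

definition weakly_above :: "point set \<Rightarrow> point set \<Rightarrow> bool" where
  "weakly_above mu lam \<longleftrightarrow> (\<forall>x y z. (x, y) \<in> lam \<longrightarrow> (x, z) \<in> mu \<longrightarrow> y \<le> z)"

section \<open>Chords and linear extensions of the chord poset\<close>

text \<open>The chord \<open>(l, r)\<close> is the horizontal segment from the upper end of an up step, in column
  \<open>l\<close>, to the upper end of its matching down step, in column \<open>r\<close>. It is a single point when
  the two steps are consecutive. With this choice of endpoints, a chord lies entirely to the
  left of another iff its right endpoint is strictly smaller than the left endpoint of the
  other, exactly as for endpoints placed at the midpoints of the two steps.\<close>

definition chords :: "point set \<Rightarrow> (int \<times> int) set" where
  "chords P = {(l, r). l \<le> r \<and>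
    (\<exists>y. (l - 1, y - 1) \<in> P \<and> (l, y) \<in> P \<and> (r, y) \<in> P \<and> (r + 1, y - 1) \<in> P \<and>
      (\<forall>x z. (x, z) \<in> P \<longrightarrow> l \<le> x \<longrightarrow> x \<le> r \<longrightarrow> y \<le> z))}"

text \<open>\<open>chord_le c d\<close>: in the chord poset, \<open>d\<close> is weakly above \<open>c\<close>.\<close>

definition chord_le :: "int \<times> int \<Rightarrow> int \<times> int \<Rightarrow> bool" where
  "chord_le c d \<longleftrightarrow> {fst d..snd d} \<subseteq> {fst c..snd c}"

definition natural_labeling :: "nat \<Rightarrow> point set \<Rightarrow> (int \<times> int \<Rightarrow> nat) \<Rightarrow> bool" where
  "natural_labeling n P L \<longleftrightarrow>
    bij_betw L (chords P) {1..n} \<and>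
    (\<forall>c\<in>chords P. \<forall>d\<in>chords P. chord_le c d \<longrightarrow> L c \<le> L d)"

definition L0 :: "point set \<Rightarrow> int \<times> int \<Rightarrow> nat" where
  "L0 P c = card {d \<in> chords P. fst d \<le> fst c}"

text \<open>The permutations \<open>L\<^sub>0 \<circ> L\<^sup>-\<^sup>1\<close> of \<open>{1..n}\<close>, extended by the identity outside \<open>{1..n}\<close>.\<close>

definition linear_extensions :: "nat \<Rightarrow> point set \<Rightarrow> (nat \<Rightarrow> nat) set" where
  "linear_extensions n P = {\<sigma>. \<sigma> permutes {1..n} \<and>
    (\<exists>L. natural_labeling n P L \<and>
      (\<forall>i\<in>{1..n}. \<sigma> i = L0 P (inv_into (chords P) L i)))}"

text \<open>If \<open>\<sigma> = L\<^sub>0 \<circ> L\<^sup>-\<^sup>1\<close>, then the chord that \<open>L\<close> labels \<open>i\<close> is \<open>L\<^sub>0\<^sup>-\<^sup>1 (\<sigma> i)\<close>.\<close>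

definition labeled_chord :: "point set \<Rightarrow> (nat \<Rightarrow> nat) \<Rightarrow> nat \<Rightarrow> int \<times> int" where
  "labeled_chord P \<sigma> i = inv_into (chords P) (L0 P) (\<sigma> i)"

text \<open>The attachment site \<open>p\<^sub>i\<close> of the vertex labeled \<open>i\<close> in the increasing plane oriented tree
  determined by \<open>(P, \<sigma>)\<close>.\<close>

definition attachment_site :: "point set \<Rightarrow> (nat \<Rightarrow> nat) \<Rightarrow> nat \<Rightarrow> nat" where
  "attachment_site P \<sigma> i =
    (let l = (\<lambda>j. fst (labeled_chord P \<sigma> j)); r = (\<lambda>j. snd (labeled_chord P \<sigma> j))
     in card {j \<in> {1..<i}. l j < l i} + card {j \<in> {1..<i}. r j < l i})"

section \<open>Cover-inclusive Dyck tilings\<close>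

text \<open>A box is a unit square rotated by 45 degrees with diagonal 2, represented by its lower
  corner: the box \<open>(x, y)\<close> has corners \<open>(x, y)\<close>, \<open>(x - 1, y + 1)\<close>, \<open>(x + 1, y + 1)\<close> and
  \<open>(x, y + 2)\<close>. Hence a set of boxes is also the set of the lower corners of its boxes, and
  for a Dyck tile this is the set of points of the translated Dyck path coordinatizing it.\<close>

definition skew_boxes :: "point set \<Rightarrow> point set \<Rightarrow> point set" where
  "skew_boxes lam mu = {(x, y). \<exists>a b. (x, a) \<in> lam \<and> (x, b) \<in> mu \<and> a \<le> y \<and> y + 2 \<le> b \<and> even (y - a)}"

definition box_adj :: "point \<Rightarrow> point \<Rightarrow> bool" where
  "box_adj b c \<longleftrightarrow> \<bar>fst b - fst c\<bar> = 1 \<and> \<bar>snd b - snd c\<bar> = 1"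

definition connected_boxes :: "point set \<Rightarrow> bool" where
  "connected_boxes B \<longleftrightarrow>
    (\<forall>b\<in>B. \<forall>c\<in>B. (b, c) \<in> {(u, v). u \<in> B \<and> v \<in> B \<and> box_adj u v}\<^sup>*)"

text \<open>\<open>box_le b c\<close>: in the coordinates of (unrotated) Young diagrams, box \<open>c\<close> is weakly greater
  than box \<open>b\<close> in both coordinates. Skew shapes (differences of two order ideals of this order)
  are its finite convex subsets.\<close>

definition box_le :: "point \<Rightarrow> point \<Rightarrow> bool" where
  "box_le b c \<longleftrightarrow>
    \<bar>fst c - fst b\<bar> \<le> snd c - snd b \<and> even ((fst c - fst b) + (snd c - snd b))"

definition skew_shape :: "point set \<Rightarrow> bool" where
  "skew_shape B \<longleftrightarrow> finite B \<and>
    (\<forall>b\<in>B. \<forall>d\<in>B. \<forall>c. box_le b c \<longrightarrow> box_le c d \<longrightarrow> c \<in> B)"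

definition ribbon :: "point set \<Rightarrow> bool" where
  "ribbon B \<longleftrightarrow> B \<noteq> {} \<and> skew_shape B \<and> connected_boxes B \<and>
    \<not> (\<exists>x y. {(x, y), (x - 1, y + 1), (x + 1, y + 1), (x, y + 2)} \<subseteq> B)"

definition dyck_tile :: "point set \<Rightarrow> bool" where
  "dyck_tile B \<longleftrightarrow> ribbon B \<and>
    (\<exists>a b h. (a, h) \<in> B \<and> (b, h) \<in> B \<and> (\<forall>(x, y)\<in>B. a \<le> x \<and> x \<le> b \<and> h \<le> y))"

definition covers :: "point set \<Rightarrow> point set \<Rightarrow> bool" where
  "covers A B \<longleftrightarrow> (\<exists>(x, y)\<in>B. (x, y + 2) \<in> A)"

record tiling =
  lower :: "point set"
  upper :: "point set"
  tiles :: "point set set"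

definition dyck_tiling :: "nat \<Rightarrow> tiling \<Rightarrow> bool" where
  "dyck_tiling n T \<longleftrightarrow>
    dyck_path n (lower T) \<and> dyck_path n (upper T) \<and> weakly_above (upper T) (lower T) \<and>
    partition_on (skew_boxes (lower T) (upper T)) (tiles T) \<and>
    (\<forall>t\<in>tiles T. dyck_tile t)"

text \<open>For connected sets of boxes, containment of horizontal extents amounts to containment of
  the sets of columns of the boxes.\<close>

definition cover_inclusive :: "tiling \<Rightarrow> bool" where
  "cover_inclusive T \<longleftrightarrow> (\<forall>A\<in>tiles T. \<forall>B\<in>tiles T. covers A B \<longrightarrow> fst ` A \<subseteq> fst ` B)"

definition cover_inclusive_tilings :: "nat \<Rightarrow> point set \<Rightarrow> tiling set" where
  "cover_inclusive_tilings n lam = {T. dyck_tiling n T \<and> cover_inclusive T \<and> lower T = lam}"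

section \<open>Strip-grow and ribbon-grow\<close>

definition spread :: "int \<Rightarrow> point set \<Rightarrow> point set" where
  "spread s P = {(x - 1, y) | x y. (x, y) \<in> P \<and> x \<le> s} \<union>
                {(x, y + 1) | x y. (x, y) \<in> P \<and> x = s} \<union>
                {(x + 1, y) | x y. (x, y) \<in> P \<and> s \<le> x}"

definition spread_tiling :: "int \<Rightarrow> tiling \<Rightarrow> tiling" where
  "spread_tiling s T =
    \<lparr>lower = spread s (lower T), upper = spread s (upper T), tiles = spread s ` tiles T\<rparr>"

text \<open>Adds the boxes in \<open>B\<close> as one-box tiles. Here \<open>B\<close> always consists of points of the upper
  boundary, which in each column of \<open>B\<close> is raised from the bottom to the top of the new box.\<close>

definition add_boxes :: "point set \<Rightarrow> tiling \<Rightarrow> tiling" where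
  "add_boxes B T =
    T\<lparr>upper := (upper T - B) \<union> {(x, y + 2) | x y. (x, y) \<in> B},
      tiles := tiles T \<union> {{b} | b. b \<in> B}\<rparr>"

text \<open>A box placed on an up step has this step as its lower right edge, so its lower corner is the
  starting point of the step.\<close>

definition strip_grow :: "tiling \<Rightarrow> int \<Rightarrow> tiling" where
  "strip_grow T s =
    (let T' = spread_tiling s T
     in add_boxes {(x, y) \<in> upper T'. s \<le> x \<and> (x + 1, y + 1) \<in> upper T'} T')"

definition eligible :: "tiling \<Rightarrow> int \<Rightarrow> bool" where
  "eligible T s \<longleftrightarrow>
    (\<exists>y. (s - 1, y - 1) \<in> upper T \<and> (s, y) \<in> upper T \<and> {(s, y - 2)} \<notin> tiles T)"

definition special_column :: "tiling \<Rightarrow> int" where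
  "special_column T = Max {s. eligible T s}"

definition ribbon_grow :: "tiling \<Rightarrow> int \<Rightarrow> tiling" where
  "ribbon_grow T s =
    (let T' = spread_tiling s T; Q = special_column T'
     in if s < Q then add_boxes {(x, y) \<in> upper T'. s < x \<and> x < Q} T' else T')"

definition empty_tiling :: tiling where
  "empty_tiling = \<lparr>lower = {(0, 0)}, upper = {(0, 0)}, tiles = {}\<rparr>"

primrec DTS_seq :: "(nat \<Rightarrow> nat) \<Rightarrow> nat \<Rightarrow> tiling" where
  "DTS_seq p 0 = empty_tiling"
| "DTS_seq p (Suc n) = strip_grow (DTS_seq p n) (int (p (Suc n)) - int n)"

primrec DTR_seq :: "(nat \<Rightarrow> nat) \<Rightarrow> nat \<Rightarrow> tiling" where
  "DTR_seq p 0 = empty_tiling"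
| "DTR_seq p (Suc n) = ribbon_grow (DTR_seq p n) (int (p (Suc n)) - int n)"

definition DTS :: "nat \<Rightarrow> point set \<Rightarrow> (nat \<Rightarrow> nat) \<Rightarrow> tiling" where
  "DTS n lam \<sigma> = DTS_seq (attachment_site lam \<sigma>) n"

definition DTR :: "nat \<Rightarrow> point set \<Rightarrow> (nat \<Rightarrow> nat) \<Rightarrow> tiling" where
  "DTR n lam \<sigma> = DTR_seq (attachment_site lam \<sigma>) n"

end

theory Submission
  imports Defs
begin

text \<open>A spread at \<open>s\<close> is the preimage under a surjective map of points that collapses the columns
  \<open>s - 1, s, s + 1\<close> to one column, so it preserves and reflects all notions involved. In a
  cover-inclusive tiling whose upper path has a peak in column \<open>s\<close> without a one-box tile
  below it, the tile below the peak must itself peak in column \<open>s\<close>, and cover-inclusiveness passes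
  the peak down to all tiles in this column and to the lower path. Hence such a tiling is a spread at \<open>s\<close>.
  After a growth step at \<open>s\<close> the special column is \<open>s\<close>, and the boxes that were added can be
  read off from the result: they lie right of \<open>s\<close>, on the top of up steps (strip-grow) or
  in the maximal run of columns topped by one-box tiles (ribbon-grow). So both growth maps are
  bijections from pairs of a tiling of order \<open>n\<close> and a site to tilings of order \<open>n + 1\<close>.
  On the other side, the chord with the largest label is a point at a peak \<open>s\<close> of the path, so
  labelings of order \<open>n + 1\<close> are obtained in the same way, by spreading at \<open>s\<close>, from labelings of
  order \<open>n\<close>, and the attachment site of the last label is \<open>s + n\<close>.\<close>

section \<open>The spread map\<close>

text \<open>The overview leaves open why the site \<open>s\<close> can be read off. A spread tile
  that meets column \<open>s\<close> also meets \<open>s - 1\<close> and \<open>s + 1\<close>, so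
  the peak carries no one-box tile and \<open>s\<close> is eligible. Strip-grow moves the upper path
  right of \<open>s\<close> by (-1, +1) and closes it with a down step; every up step of the moved
  part ends on top of a new box. A nonempty ribbon turns the down step after \<open>s\<close> into
  an up step onto a new box, and the up step into the old special column into a down step. In both
  cases no column right of \<open>s\<close> stays eligible. The bijection is proved for all lower
  paths together. It restricts to a fixed path because growth spreads the lower boundary exactly as
  it spreads the path that carries the chords. The number \<open>s + n\<close> counts the steps of a
  path of order \<open>n\<close> up to column \<open>s\<close>, each of them charged to the chord it
  belongs to.\<close>

definition squeeze :: "int \<Rightarrow> point \<Rightarrow> point" where
  "squeeze s = (\<lambda>(x, y). if x < s then (x + 1, y) else if x = s then (x, y - 1) else (x - 1, y))"

text \<open>Within one column all heights drop by the same amount, so order, differences and parity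
  of heights in a column survive. This is why the column part and the height part of
  \<open>squeeze\<close> are separated.\<close>

definition squeeze_col :: "int \<Rightarrow> int \<Rightarrow> int" where
  "squeeze_col s x = (if x < s then x + 1 else if x = s then x else x - 1)"

definition squeeze_drop :: "int \<Rightarrow> int \<Rightarrow> int" where
  "squeeze_drop s x = (if x = s then 1 else 0)"

lemma squeeze_eq: "squeeze s (x, y) = (squeeze_col s x, y - squeeze_drop s x)"
  by (simp add: squeeze_def squeeze_col_def squeeze_drop_def)

lemma spread_eq_vimage: "spread s P = squeeze s -` P"
proof -
  have "(x, y) \<in> spread s P \<longleftrightarrow> (x < s \<and> (x + 1, y) \<in> P) \<or> (x = s \<and> (x, y - 1) \<in> P) \<or>
    (x > s \<and> (x - 1, y) \<in> P)" for x y
  proof -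
    have "(\<exists>x'. x = x' - 1 \<and> (x', y) \<in> P \<and> x' \<le> s) \<longleftrightarrow> x < s \<and> (x + 1, y) \<in> P"
      by (auto intro: exI[of _ "x + 1"])
    moreover have "(\<exists>y'. y = y' + 1 \<and> (x, y') \<in> P) \<longleftrightarrow> (x, y - 1) \<in> P"
      by (auto intro: exI[of _ "y - 1"])
    moreover have "(\<exists>x'. x = x' + 1 \<and> (x', y) \<in> P \<and> s \<le> x') \<longleftrightarrow> x > s \<and> (x - 1, y) \<in> P"
      by (auto intro: exI[of _ "x - 1"])
    ultimately show ?thesis unfolding spread_def by fastforce
  qed
  then show ?thesis by (auto simp: squeeze_def split: if_splits)
qed

lemma mem_spread: "(x, y) \<in> spread s P \<longleftrightarrow> (squeeze_col s x, y - squeeze_drop s x) \<in> P"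
  by (simp add: spread_eq_vimage squeeze_eq)

lemma squeeze_col_surj: "\<exists>x'. squeeze_col s x' = x"
proof -
  have "squeeze_col s (if x \<le> s then x - 1 else x + 1) = x"
    by (auto simp: squeeze_col_def)
  then show ?thesis by blast
qed

lemma squeeze_surj: "\<exists>q. squeeze s q = r"
proof -
  obtain x y where r: "r = (x, y)" by fastforce
  obtain x' where "squeeze_col s x' = x" using squeeze_col_surj by blast
  then have "squeeze s (x', y + squeeze_drop s x') = r" by (simp add: squeeze_eq r)
  then show ?thesis by blast
qed

lemma spread_subset_iff: "spread s P \<subseteq> spread s Q \<longleftrightarrow> P \<subseteq> Q"
proof
  assume sub: "spread s P \<subseteq> spread s Q"
  show "P \<subseteq> Q"
  proof
    fix r assume "r \<in> P"
    moreover obtain q where "squeeze s q = r" using squeeze_surj by blast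
    ultimately show "r \<in> Q" using sub unfolding spread_eq_vimage by blast
  qed
qed (auto simp: spread_eq_vimage)

lemma spread_eq_iff: "spread s P = spread s Q \<longleftrightarrow> P = Q"
  by (simp add: set_eq_subset spread_subset_iff)

lemma inj_spread: "inj (spread s)"
  by (simp add: inj_def spread_eq_iff)

text \<open>Preimages commute with unions and intersections, and under a surjection only the empty
  set has an empty preimage.\<close>

lemma partition_on_spread:
  "partition_on (spread s S) (spread s ` \<T>) \<longleftrightarrow> partition_on S \<T>"
proof -
  have e: "spread s {} = {}" by (simp add: spread_eq_vimage)
  have u: "\<Union> (spread s ` \<T>) = spread s (\<Union> \<T>)" by (auto simp: spread_eq_vimage)
  have d: "spread s A \<inter> spread s B = {} \<longleftrightarrow> A \<inter> B = {}" for A B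
    unfolding spread_eq_iff[of s "A \<inter> B" "{}", symmetric] e by (simp add: spread_eq_vimage)
  have "{} \<in> spread s ` \<T> \<longleftrightarrow> {} \<in> \<T>"
    using inj_image_mem_iff[OF inj_spread, of s "{}" \<T>] unfolding e .
  moreover have "disjoint (spread s ` \<T>) \<longleftrightarrow> disjoint \<T>"
    unfolding disjoint_def by (simp add: d spread_eq_iff)
  ultimately show ?thesis
    unfolding partition_on_def u spread_eq_iff by blast
qed

lemma skew_boxes_spread:
  "skew_boxes (spread s lam) (spread s mu) = spread s (skew_boxes lam mu)"
proof -
  have "(x, y) \<in> skew_boxes (spread s lam) (spread s mu) \<longleftrightarrow> (x, y) \<in> spread s (skew_boxes lam mu)"
    for x y
  proof
    assume "(x, y) \<in> skew_boxes (spread s lam) (spread s mu)"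
    then obtain a b where *: "(x, a) \<in> spread s lam" "(x, b) \<in> spread s mu"
      "a \<le> y" "y + 2 \<le> b" "even (y - a)"
      by (auto simp: skew_boxes_def)
    let ?d = "squeeze_drop s x"
    have "(squeeze_col s x, a - ?d) \<in> lam" "(squeeze_col s x, b - ?d) \<in> mu"
      "a - ?d \<le> y - ?d" "y - ?d + 2 \<le> b - ?d" "even (y - ?d - (a - ?d))"
      using * by (auto simp: mem_spread)
    then show "(x, y) \<in> spread s (skew_boxes lam mu)"
      unfolding mem_spread skew_boxes_def by blast
  next
    assume "(x, y) \<in> spread s (skew_boxes lam mu)"
    then obtain a b where *: "(squeeze_col s x, a) \<in> lam" "(squeeze_col s x, b) \<in> mu"
      "a \<le> y - squeeze_drop s x" "y - squeeze_drop s x + 2 \<le> b" "even (y - squeeze_drop s x - a)"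
      by (auto simp: skew_boxes_def mem_spread)
    let ?d = "squeeze_drop s x"
    have "(x, a + ?d) \<in> spread s lam" "(x, b + ?d) \<in> spread s mu"
      "a + ?d \<le> y" "y + 2 \<le> b + ?d" "even (y - (a + ?d))"
      using * by (auto simp: mem_spread algebra_simps)
    then show "(x, y) \<in> skew_boxes (spread s lam) (spread s mu)"
      unfolding skew_boxes_def by blast
  qed
  then show ?thesis by auto
qed

lemma covers_spread: "covers (spread s A) (spread s B) \<longleftrightarrow> covers A B"
proof
  assume "covers (spread s A) (spread s B)"
  then obtain x y where "(x, y) \<in> spread s B" "(x, y + 2) \<in> spread s A"
    by (auto simp: covers_def)
  then have "(squeeze_col s x, y - squeeze_drop s x) \<in> B"
    "(squeeze_col s x, y - squeeze_drop s x + 2) \<in> A"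
    by (auto simp: mem_spread algebra_simps)
  then show "covers A B" unfolding covers_def by blast
next
  assume "covers A B"
  then obtain x y where xy: "(x, y) \<in> B" "(x, y + 2) \<in> A" by (auto simp: covers_def)
  obtain x' where "squeeze_col s x' = x" using squeeze_col_surj by blast
  then have "(x', y + squeeze_drop s x') \<in> spread s B" "(x', y + squeeze_drop s x' + 2) \<in> spread s A"
    using xy by (auto simp: mem_spread)
  then show "covers (spread s A) (spread s B)" unfolding covers_def by blast
qed

lemma columns_spread: "fst ` spread s A = squeeze_col s -` fst ` A"
proof -
  have "x \<in> fst ` spread s A \<longleftrightarrow> squeeze_col s x \<in> fst ` A" for x
  proof
    assume "x \<in> fst ` spread s A"
    then obtain y where "(x, y) \<in> spread s A" by auto
    then show "squeeze_col s x \<in> fst ` A" by (metis fst_conv imageI mem_spread)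
  next
    assume "squeeze_col s x \<in> fst ` A"
    then obtain y where "(squeeze_col s x, y) \<in> A" by auto
    then have "(x, y + squeeze_drop s x) \<in> spread s A" by (simp add: mem_spread)
    then show "x \<in> fst ` spread s A" by (metis fst_conv imageI)
  qed
  then show ?thesis by blast
qed

lemma columns_spread_subset_iff: "fst ` spread s A \<subseteq> fst ` spread s B \<longleftrightarrow> fst ` A \<subseteq> fst ` B"
proof -
  have "squeeze_col s -` C \<subseteq> squeeze_col s -` D \<longleftrightarrow> C \<subseteq> D" for C D
    using squeeze_col_surj[of s] by (auto, metis subsetD vimage_eq)
  then show ?thesis unfolding columns_spread .
qed

lemma weakly_above_spread: "weakly_above (spread s mu) (spread s lam) \<longleftrightarrow> weakly_above mu lam"
proof
  assume *: "weakly_above (spread s mu) (spread s lam)"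
  show "weakly_above mu lam"
    unfolding weakly_above_def
  proof (intro allI impI)
    fix x y z assume **: "(x, y) \<in> lam" "(x, z) \<in> mu"
    obtain x' where "squeeze_col s x' = x" using squeeze_col_surj by blast
    with ** have "(x', y + squeeze_drop s x') \<in> spread s lam" "(x', z + squeeze_drop s x') \<in> spread s mu"
      by (auto simp: mem_spread)
    with * have "y + squeeze_drop s x' \<le> z + squeeze_drop s x'" unfolding weakly_above_def by blast
    then show "y \<le> z" by simp
  qed
next
  assume *: "weakly_above mu lam"
  show "weakly_above (spread s mu) (spread s lam)"
    unfolding weakly_above_def
  proof (intro allI impI)
    fix x y z assume "(x, y) \<in> spread s lam" "(x, z) \<in> spread s mu"
    with * have "y - squeeze_drop s x \<le> z - squeeze_drop s x"
      unfolding weakly_above_def mem_spread by blast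
    then show "y \<le> z" by simp
  qed
qed

lemma cover_inclusive_spread: "cover_inclusive (spread_tiling s T) \<longleftrightarrow> cover_inclusive T"
  by (simp add: cover_inclusive_def spread_tiling_def covers_spread columns_spread_subset_iff)

lemma inj_spread_tiling: "inj (spread_tiling s)"
proof (rule injI)
  fix T T' assume eq: "spread_tiling s T = spread_tiling s T'"
  have "lower T = lower T'" "upper T = upper T'" "tiles T = tiles T'"
    using eq unfolding spread_tiling_def
    by (auto simp: spread_eq_iff inj_image_eq_iff[OF inj_spread])
  then show "T = T'" by simp
qed

text \<open>The sets of the form \<open>spread s P\<close> are the unions of fibres of \<open>squeeze s\<close>.\<close>

definition peaked :: "int \<Rightarrow> point set \<Rightarrow> bool" where
  "peaked s Q \<longleftrightarrow> (\<forall>y. ((s - 1, y) \<in> Q \<longleftrightarrow> (s, y + 1) \<in> Q) \<and> ((s + 1, y) \<in> Q \<longleftrightarrow> (s, y + 1) \<in> Q))"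

lemma peakedD:
  assumes "peaked s Q"
  shows "(s - 1, y) \<in> Q \<longleftrightarrow> (s, y + 1) \<in> Q" "(s + 1, y) \<in> Q \<longleftrightarrow> (s, y + 1) \<in> Q"
  using assms unfolding peaked_def by blast+

lemma peaked_spread: "peaked s (spread s P)"
  by (simp add: peaked_def mem_spread squeeze_col_def squeeze_drop_def)

text \<open>The only fibres of \<open>squeeze s\<close> with several points lie over column
  \<open>s\<close>. They consist of \<open>(s - 1, y)\<close>, \<open>(s, y + 1)\<close> and
  \<open>(s + 1, y)\<close>, and a peaked set contains all three or none.\<close>

lemma spread_squeeze_image:
  assumes "peaked s Q"
  shows "spread s (squeeze s ` Q) = Q"
proof -
  have "q \<in> Q" if "squeeze s q = squeeze s r" "r \<in> Q" for q r
  proof -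
    obtain x y x' y' where q: "q = (x, y)" and r: "r = (x', y')" by fastforce
    have col: "squeeze_col s x = squeeze_col s x'" and drop: "y - squeeze_drop s x = y' - squeeze_drop s x'"
      using that(1) unfolding q r squeeze_eq by simp_all
    show ?thesis
    proof (cases "squeeze_col s x = s")
      case False
      with col have "x = x'" by (simp add: squeeze_col_def split: if_splits)
      with drop that(2) show ?thesis unfolding q r by simp
    next
      case True
      with col have x: "x \<in> {s - 1, s, s + 1}" and x': "x' \<in> {s - 1, s, s + 1}"
        by (auto simp: squeeze_col_def split: if_splits)
      have fibre: "(z, w) \<in> Q \<longleftrightarrow> (s, w - squeeze_drop s z + 1) \<in> Q" if "z \<in> {s - 1, s, s + 1}" for z w
        using that peakedD[OF assms, of w] by (elim insertE) (simp_all add: squeeze_drop_def)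
      show ?thesis
        using fibre[OF x, of y] fibre[OF x', of y'] that(2) unfolding q r drop by simp
    qed
  qed
  then show ?thesis unfolding spread_eq_vimage by blast
qed

section \<open>Dyck paths under spreads\<close>

definition graph_on :: "int \<Rightarrow> int \<Rightarrow> (int \<Rightarrow> int) \<Rightarrow> point set" where
  "graph_on a b h = {(x, h x) | x. a \<le> x \<and> x \<le> b}"

lemma mem_graph_on: "(x, y) \<in> graph_on a b h \<longleftrightarrow> a \<le> x \<and> x \<le> b \<and> y = h x"
  by (auto simp: graph_on_def)

lemma graph_on_cong:
  assumes "\<And>x. a \<le> x \<Longrightarrow> x \<le> b \<Longrightarrow> h x = k x"
  shows "graph_on a b h = graph_on a b k"
  using assms by (auto simp: graph_on_def)

text \<open>Boundary paths and Dyck tiles are both graphs of such functions, so one lemma on lifted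
  arcs serves both. The case \<open>a = b\<close> covers the path of order 0 and the one-box
  tile.\<close>

definition dyck_arc :: "int \<Rightarrow> int \<Rightarrow> (int \<Rightarrow> int) \<Rightarrow> bool" where
  "dyck_arc a b h \<longleftrightarrow> a \<le> b \<and> (\<forall>x. a \<le> x \<longrightarrow> x < b \<longrightarrow> \<bar>h (x + 1) - h x\<bar> = 1) \<and>
    h a = h b \<and> (\<forall>x. a \<le> x \<longrightarrow> x \<le> b \<longrightarrow> h a \<le> h x)"

lemma dyck_arcD:
  assumes "dyck_arc a b h"
  shows "a \<le> b" "a \<le> x \<Longrightarrow> x < b \<Longrightarrow> h (x + 1) = h x + 1 \<or> h (x + 1) = h x - 1"
    "h b = h a" "a \<le> x \<Longrightarrow> x \<le> b \<Longrightarrow> h a \<le> h x"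
proof -
  show "a \<le> b" "h b = h a" using assms unfolding dyck_arc_def by simp_all
  show "a \<le> x \<Longrightarrow> x \<le> b \<Longrightarrow> h a \<le> h x" using assms unfolding dyck_arc_def by blast
  assume "a \<le> x" "x < b"
  then have "\<bar>h (x + 1) - h x\<bar> = 1" using assms unfolding dyck_arc_def by blast
  then show "h (x + 1) = h x + 1 \<or> h (x + 1) = h x - 1" by linarith
qed

lemma dyck_arcI:
  assumes "a \<le> b" "\<And>x. a \<le> x \<Longrightarrow> x < b \<Longrightarrow> h (x + 1) = h x + 1 \<or> h (x + 1) = h x - 1"
    "h a = h b" "\<And>x. a \<le> x \<Longrightarrow> x \<le> b \<Longrightarrow> h a \<le> h x"
  shows "dyck_arc a b h"
proof -
  have "\<bar>h (x + 1) - h x\<bar> = 1" if "a \<le> x" "x < b" for x using assms(2)[OF that] by linarith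
  then show ?thesis unfolding dyck_arc_def using assms(1,3,4) by blast
qed

text \<open>A point set determines the height function only between \<open>a\<close> and
  \<open>b\<close>; this permits replacing it by another one with the same graph.\<close>

lemma dyck_arc_cong:
  assumes "graph_on a b h = graph_on a b k"
  shows "dyck_arc a b h \<longleftrightarrow> dyck_arc a b k"
proof -
  have eq: "h x = k x" if "a \<le> x" "x \<le> b" for x
    using assms that mem_graph_on[of x "h x" a b h] mem_graph_on[of x "h x" a b k] by simp
  have "dyck_arc a b h \<Longrightarrow> dyck_arc a b k" if "\<And>x. a \<le> x \<Longrightarrow> x \<le> b \<Longrightarrow> h x = k x" for h k
    using that that[of a] that[of b] unfolding dyck_arc_def by auto
  from this[of h k] this[of k h] show ?thesis using eq by auto
qed

lemma dyck_path_iff: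
  "dyck_path n P \<longleftrightarrow> (\<exists>h. dyck_arc (- int n) (int n) h \<and> h (- int n) = 0 \<and> P = graph_on (- int n) (int n) h)"
  unfolding dyck_path_def dyck_arc_def graph_on_def
  by (rule ex_cong1) auto

text \<open>The preimage of the interval from \<open>a\<close> to \<open>b\<close> under
  \<open>squeeze_col s\<close> is the interval between these two ends. An end at \<open>s\<close>
  itself moves outwards, hence the different conditions for left and right ends. Ends of chords move
  in the same way.\<close>

definition left_end :: "int \<Rightarrow> int \<Rightarrow> int" where
  "left_end s a = (if a \<le> s then a - 1 else a + 1)"

definition right_end :: "int \<Rightarrow> int \<Rightarrow> int" where
  "right_end s b = (if b < s then b - 1 else b + 1)"

definition lift_height :: "int \<Rightarrow> (int \<Rightarrow> int) \<Rightarrow> int \<Rightarrow> int" where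
  "lift_height s h x = h (squeeze_col s x) + squeeze_drop s x"

lemma left_end_le_iff: "left_end s a \<le> x \<longleftrightarrow> a \<le> squeeze_col s x"
  and le_right_end_iff: "x \<le> right_end s b \<longleftrightarrow> squeeze_col s x \<le> b"
  by (auto simp: squeeze_col_def left_end_def right_end_def)

lemma spread_graph_on:
  "spread s (graph_on a b h) = graph_on (left_end s a) (right_end s b) (lift_height s h)"
proof -
  have "(x, y) \<in> spread s (graph_on a b h) \<longleftrightarrow>
    (x, y) \<in> graph_on (left_end s a) (right_end s b) (lift_height s h)" for x y
    unfolding mem_spread mem_graph_on lift_height_def left_end_le_iff le_right_end_iff by auto
  then show ?thesis by auto
qed

lemma lift_height_simps:
  "x < s \<Longrightarrow> lift_height s h x = h (x + 1)" "lift_height s h s = h s + 1"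
  "s < x \<Longrightarrow> lift_height s h x = h (x - 1)"
  by (auto simp: lift_height_def squeeze_col_def squeeze_drop_def)

text \<open>This is a section of \<open>squeeze_col s\<close> that avoids column \<open>s\<close>,
  where the lift is raised.\<close>

lemma lift_height_col: "lift_height s h (if x \<le> s then x - 1 else x + 1) = h x"
  by (simp add: lift_height_simps)

text \<open>The lift repeats the steps of \<open>h\<close>, with an up step and a down step inserted
  around \<open>s\<close> if \<open>s\<close> lies between the ends. The inserted peak is above its
  neighbours, so it does not affect the minimum. An interval is empty iff its preimage is.\<close>

lemma dyck_arc_lift:
  "dyck_arc (left_end s a) (right_end s b) (lift_height s h) \<longleftrightarrow> dyck_arc a b h" (is "?L \<longleftrightarrow> ?R")
proof (cases "a \<le> b")
  case False
  then have "\<not> ?R" by (simp add: dyck_arc_def)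
  moreover have "\<not> ?L"
  proof
    assume L: ?L
    then have "left_end s a \<le> right_end s b" by (simp add: dyck_arc_def)
    then show False using False by (auto simp: left_end_def right_end_def split: if_splits)
  qed
  ultimately show ?thesis by simp
next
  case True
  have le: "left_end s a \<le> right_end s b" using True by (auto simp: left_end_def right_end_def)
  have ha: "lift_height s h (left_end s a) = h a"
    using lift_height_col[of s h a] by (simp add: left_end_def)
  have hb: "lift_height s h (right_end s b) = h b"
    by (simp add: right_end_def lift_height_simps)
  show ?thesis
  proof
    assume L: ?L
    show ?R
    proof (rule dyck_arcI)
      fix x assume x: "a \<le> x" "x < b"
      consider "x < s" | "x \<ge> s" by linarith
      then show "h (x + 1) = h x + 1 \<or> h (x + 1) = h x - 1"
      proof cases
        case 1
        then show ?thesis using dyck_arcD(2)[OF L, of "x - 1"] x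
          by (simp add: lift_height_simps left_end_def right_end_def split: if_splits)
      next
        case 2
        then show ?thesis using dyck_arcD(2)[OF L, of "x + 1"] x
          by (simp add: add.commute[of 1] lift_height_simps left_end_def right_end_def split: if_splits)
      qed
    next
      fix x assume x: "a \<le> x" "x \<le> b"
      then show "h a \<le> h x"
        using dyck_arcD(4)[OF L, of "if x \<le> s then x - 1 else x + 1"]
        unfolding lift_height_col ha by (simp add: left_end_def right_end_def split: if_splits)
    next
      show "h a = h b" using dyck_arcD(3)[OF L] ha hb by simp
    qed (fact True)
  next
    assume R: ?R
    show ?L
    proof (rule dyck_arcI)
      fix x assume x: "left_end s a \<le> x" "x < right_end s b"
      consider "x < s - 1" | "x = s - 1" | "x = s" | "x > s" by linarith
      then show "lift_height s h (x + 1) = lift_height s h x + 1 \<or>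
        lift_height s h (x + 1) = lift_height s h x - 1"
      proof cases
        case 1
        then show ?thesis using dyck_arcD(2)[OF R, of "x + 1"] x
          by (simp add: lift_height_simps left_end_def right_end_def split: if_splits)
      next
        case 4
        then show ?thesis using dyck_arcD(2)[OF R, of "x - 1"] x
          by (simp add: lift_height_simps left_end_def right_end_def split: if_splits)
      qed (simp_all add: lift_height_simps)
    next
      fix x assume x: "left_end s a \<le> x" "x \<le> right_end s b"
      consider "x < s" | "x = s" | "x > s" by linarith
      then show "lift_height s h (left_end s a) \<le> lift_height s h x"
      proof cases
        case 1
        then show ?thesis unfolding ha using dyck_arcD(4)[OF R, of "x + 1"] x
          by (simp add: lift_height_simps left_end_def right_end_def split: if_splits)
      next
        case 2
        then show ?thesis unfolding ha using dyck_arcD(4)[OF R, of s] x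
          by (simp add: lift_height_simps left_end_def right_end_def split: if_splits)
      next
        case 3
        then show ?thesis unfolding ha using dyck_arcD(4)[OF R, of "x - 1"] x
          by (simp add: lift_height_simps left_end_def right_end_def split: if_splits)
      qed
    qed (use le ha hb dyck_arcD(3)[OF R] in simp_all)
  qed
qed

lemma peaked_graph_on:
  assumes pk: "peaked s (graph_on a' b' h')" and "a' \<le> b'"
  obtains a b h where "left_end s a = a'" "right_end s b = b'"
    "graph_on a' b' h' = graph_on a' b' (lift_height s h)"
proof -
  \<comment> \<open>Peakedness forces the columns \<open>s - 1\<close>, \<open>s\<close> and
    \<open>s + 1\<close> to lie all inside or all outside the range of the graph.\<close>
  have col: "a' \<le> s - 1 \<and> s - 1 \<le> b' \<longleftrightarrow> a' \<le> s \<and> s \<le> b'" "a' \<le> s + 1 \<and> s + 1 \<le> b' \<longleftrightarrow> a' \<le> s \<and> s \<le> b'"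
    using peakedD(1)[OF pk, of "h' s - 1"] peakedD(1)[OF pk, of "h' (s - 1)"]
      peakedD(2)[OF pk, of "h' s - 1"] peakedD(2)[OF pk, of "h' (s + 1)"]
    unfolding mem_graph_on by (metis diff_add_cancel)+
  define a where "a = (if a' < s then a' + 1 else a' - 1)"
  define b where "b = (if s < b' then b' - 1 else b' + 1)"
  \<comment> \<open>Column \<open>s\<close> of \<open>h\<close> takes the height at the foot of the
    peak, read off in column \<open>s - 1\<close>.\<close>
  define h where "h x = h' (if x \<le> s then x - 1 else x + 1)" for x
  have "left_end s a = a'" "right_end s b = b'"
    using col \<open>a' \<le> b'\<close> by (auto simp: left_end_def right_end_def a_def b_def)
  moreover have "graph_on a' b' h' = graph_on a' b' (lift_height s h)"
  proof (rule graph_on_cong)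
    fix x assume x: "a' \<le> x" "x \<le> b'"
    consider "x < s" | "x = s" | "x = s + 1" | "x > s + 1" by linarith
    then show "h' x = lift_height s h x"
    proof cases
      case 2
      then show ?thesis using x col peakedD(1)[OF pk, of "h' (s - 1)"]
        unfolding mem_graph_on by (auto simp: lift_height_simps h_def)
    next
      case 3
      then show ?thesis using x col peakedD[OF pk, of "h' (s - 1)"]
        unfolding mem_graph_on by (auto simp: lift_height_simps h_def)
    qed (auto simp: lift_height_simps h_def)
  qed
  ultimately show ?thesis using that by blast
qed

text \<open>The bounds on \<open>s\<close> ensure that both ends of the path move outwards, so that
  the order grows by exactly one.\<close>

lemma dyck_path_spread:
  assumes "- int n \<le> s" "s \<le> int n"
  shows "dyck_path (Suc n) (spread s P) \<longleftrightarrow> dyck_path n P"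
proof
  assume "dyck_path n P"
  then obtain h where h: "dyck_arc (- int n) (int n) h" "h (- int n) = 0" "P = graph_on (- int n) (int n) h"
    unfolding dyck_path_iff by blast
  have e: "left_end s (- int n) = - int (Suc n)" "right_end s (int n) = int (Suc n)"
    using assms by (auto simp: left_end_def right_end_def)
  have "dyck_arc (- int (Suc n)) (int (Suc n)) (lift_height s h)"
    using h(1) dyck_arc_lift[of s "- int n" "int n" h] unfolding e by simp
  moreover have "lift_height s h (- int (Suc n)) = 0"
    using lift_height_simps(1)[of "- int (Suc n)" s h] assms h(2) by simp
  moreover have "spread s P = graph_on (- int (Suc n)) (int (Suc n)) (lift_height s h)"
    unfolding h(3) spread_graph_on e ..
  ultimately show "dyck_path (Suc n) (spread s P)" unfolding dyck_path_iff by blast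
next
  assume "dyck_path (Suc n) (spread s P)"
  then obtain h' where h': "dyck_arc (- int (Suc n)) (int (Suc n)) h'" "h' (- int (Suc n)) = 0"
    "spread s P = graph_on (- int (Suc n)) (int (Suc n)) h'"
    unfolding dyck_path_iff by blast
  obtain a b h where ab: "left_end s a = - int (Suc n)" "right_end s b = int (Suc n)"
    and eq: "graph_on (- int (Suc n)) (int (Suc n)) h' = graph_on (- int (Suc n)) (int (Suc n)) (lift_height s h)"
    using peaked_graph_on[of s "- int (Suc n)" "int (Suc n)" h'] peaked_spread[of s P] unfolding h'(3) by auto
  have a: "a = - int n" and b: "b = int n"
    using ab assms by (auto simp: left_end_def right_end_def split: if_splits)
  have "dyck_arc (left_end s a) (right_end s b) (lift_height s h)"
    using h'(1) dyck_arc_cong[OF eq] ab by simp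
  then have "dyck_arc (- int n) (int n) h" unfolding dyck_arc_lift a b .
  moreover have "spread s P = spread s (graph_on (- int n) (int n) h)"
    unfolding spread_graph_on h'(3) eq using ab a b by simp
  then have "P = graph_on (- int n) (int n) h" by (simp add: spread_eq_iff)
  moreover have "h (- int n) = 0"
  proof -
    have "(- int (Suc n), 0) \<in> graph_on (- int (Suc n)) (int (Suc n)) (lift_height s h)"
      unfolding eq[symmetric] mem_graph_on using h'(2) by simp
    then show ?thesis using assms unfolding mem_graph_on by (simp add: lift_height_simps)
  qed
  ultimately show "dyck_path n P" unfolding dyck_path_iff by blast
qed

section \<open>Dyck tiles under spreads\<close>

lemma dyck_arc_lipschitz:
  assumes "dyck_arc a b h" "a \<le> x" "x \<le> z" "z \<le> b"
  shows "\<bar>h z - h x\<bar> \<le> z - x"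
  using \<open>x \<le> z\<close> \<open>z \<le> b\<close>
proof (induction z rule: int_ge_induct)
  case (step i)
  then have "h (i + 1) = h i + 1 \<or> h (i + 1) = h i - 1"
    using dyck_arcD(2)[OF assms(1), of i] assms(2) by auto
  with step show ?case by auto
qed simp

lemma dyck_arc_parity:
  assumes "dyck_arc a b h" "a \<le> x" "x \<le> z" "z \<le> b"
  shows "even (h z - h x - (z - x))"
  using \<open>x \<le> z\<close> \<open>z \<le> b\<close>
proof (induction z rule: int_ge_induct)
  case (step i)
  then have "h (i + 1) = h i + 1 \<or> h (i + 1) = h i - 1"
    using dyck_arcD(2)[OF assms(1), of i] assms(2) by auto
  with step show ?case by (elim disjE) auto
qed simp

text \<open>Unit steps make \<open>h\<close> 1-Lipschitz, which yields convexity; walking along the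
  graph yields connectedness; one box per column excludes a 2x2 square.\<close>

lemma dyck_tile_graph_on:
  assumes "dyck_arc a b h"
  shows "dyck_tile (graph_on a b h)"
proof -
  let ?B = "graph_on a b h"
  note ab = dyck_arcD(1)[OF assms]
  have "finite ?B"
  proof -
    have "?B = (\<lambda>x. (x, h x)) ` {a..b}" by (auto simp: graph_on_def)
    then show ?thesis by simp
  qed
  moreover have convex: "c \<in> ?B" if pq: "p \<in> ?B" "q \<in> ?B" and "box_le p c" "box_le c q" for p q c
  proof -
    obtain x z w v where eq: "p = (x, h x)" "q = (z, h z)" "c = (w, v)"
      and x: "a \<le> x" "x \<le> b" and z: "a \<le> z" "z \<le> b"
      using pq by (cases c) (auto simp: graph_on_def)
    have le: "\<bar>w - x\<bar> \<le> v - h x" "\<bar>z - w\<bar> \<le> h z - v"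
      using that(3,4) unfolding eq box_le_def by simp_all
    have "\<bar>h z - h x\<bar> \<le> \<bar>z - x\<bar>"
    proof (cases "x \<le> z")
      case True
      then show ?thesis using dyck_arc_lipschitz[OF assms x(1) _ z(2)] by simp
    next
      case False
      then show ?thesis using dyck_arc_lipschitz[OF assms z(1) _ x(2)] by simp
    qed
    \<comment> \<open>Adding the two \<open>box_le\<close> inequalities gives a rise of at least the
      total column distance, while the Lipschitz bound allows at most
      \<open>\<bar>z - x\<bar>\<close>. So \<open>w\<close> lies between \<open>x\<close> and
      \<open>z\<close> and every inequality is tight, which forces \<open>v = h w\<close>.\<close>
    with le have w: "\<bar>w - x\<bar> + \<bar>z - w\<bar> \<le> \<bar>z - x\<bar>" by linarith
    have wab: "a \<le> w" "w \<le> b" using w x z by linarith+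
    have "\<bar>h w - h x\<bar> \<le> \<bar>w - x\<bar>" "\<bar>h z - h w\<bar> \<le> \<bar>z - w\<bar>"
      using dyck_arc_lipschitz[OF assms x(1) _ wab(2)] dyck_arc_lipschitz[OF assms wab(1) _ x(2)]
        dyck_arc_lipschitz[OF assms z(1) _ wab(2)] dyck_arc_lipschitz[OF assms wab(1) _ z(2)]
      by linarith+
    then have "v = h w" using le \<open>\<bar>h z - h x\<bar> \<le> \<bar>z - x\<bar>\<close> w by linarith
    then show ?thesis using wab unfolding eq mem_graph_on by simp
  qed
  moreover have "connected_boxes ?B"
  proof -
    let ?R = "{(u, v). u \<in> ?B \<and> v \<in> ?B \<and> box_adj u v}"
    have sym: "sym ?R" by (rule symI) (auto simp: box_adj_def)
    have up: "((x, h x), (z, h z)) \<in> ?R\<^sup>*" if "a \<le> x" "x \<le> z" "z \<le> b" for x z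
      using that(2,3)
    proof (induction z rule: int_ge_induct)
      case (step i)
      then have "h (i + 1) = h i + 1 \<or> h (i + 1) = h i - 1"
        using dyck_arcD(2)[OF assms, of i] that(1) by auto
      then have "((i, h i), (i + 1, h (i + 1))) \<in> ?R"
        using step that(1) by (auto simp: box_adj_def mem_graph_on)
      with step show ?case by (meson rtrancl.rtrancl_into_rtrancl order.trans zle_add1_eq_le less_imp_le zless_add1_eq)
    qed simp
    have "((x, h x), (z, h z)) \<in> ?R\<^sup>*" if "a \<le> x" "x \<le> b" "a \<le> z" "z \<le> b" for x z
      using up[of x z] up[of z x] symD[OF sym_rtrancl[OF sym]] that by (meson linear)
    then show ?thesis unfolding connected_boxes_def by (auto simp: graph_on_def)
  qed
  moreover have "?B \<noteq> {}" "\<not> {(x, y), (x - 1, y + 1), (x + 1, y + 1), (x, y + 2)} \<subseteq> ?B" for x y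
    using ab by (auto simp: graph_on_def)
  ultimately have "ribbon ?B"
    unfolding ribbon_def skew_shape_def by (simp only: simp_thms not_ex) (meson convex)
  moreover have "(a, h a) \<in> ?B" "(b, h a) \<in> ?B"
    using ab dyck_arcD(3)[OF assms] by (auto simp: mem_graph_on)
  moreover have "\<forall>(x, y)\<in>?B. a \<le> x \<and> x \<le> b \<and> h a \<le> y"
    using dyck_arcD(4)[OF assms] by (auto simp: mem_graph_on)
  ultimately show ?thesis
    unfolding dyck_tile_def by blast
qed

section \<open>Recovering a height function from a Dyck tile\<close>

lemma connected_boxes_crossing:
  assumes "connected_boxes B" "p \<in> B" "q \<in> B" "fst p \<le> x" "x < fst q"
  shows "\<exists>y z. (x, y) \<in> B \<and> (x + 1, z) \<in> B \<and> \<bar>z - y\<bar> = 1"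
proof -
  let ?R = "{(u, v). u \<in> B \<and> v \<in> B \<and> box_adj u v}"
  have "(p, q) \<in> ?R\<^sup>*" using assms unfolding connected_boxes_def by blast
  then show ?thesis using \<open>x < fst q\<close>
  proof (induction rule: rtrancl_induct)
    case base
    then show ?case using assms(4) by simp
  next
    case (step u v)
    show ?case
    proof (cases "x < fst u")
      case False
      with step.hyps(2) step.prems have "fst u = x" "fst v = x + 1" "\<bar>snd v - snd u\<bar> = 1"
        by (auto simp: box_adj_def)
      moreover have "u \<in> B" "v \<in> B" using step.hyps(2) by auto
      ultimately show ?thesis by (metis prod.collapse)
    qed (use step in blast)
  qed
qed

lemma connected_boxes_parity:
  assumes "connected_boxes B" "(x, y) \<in> B" "(x', y') \<in> B"
  shows "even (x' - x + (y' - y))"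
proof -
  let ?R = "{(u, v). u \<in> B \<and> v \<in> B \<and> box_adj u v}"
  have "((x, y), (x', y')) \<in> ?R\<^sup>*" using assms unfolding connected_boxes_def by blast
  then have "even (fst (x', y') - x + (snd (x', y') - y))"
  proof (induction rule: rtrancl_induct)
    case (step u v)
    then have "fst v = fst u + 1 \<or> fst v = fst u - 1" "snd v = snd u + 1 \<or> snd v = snd u - 1"
      by (auto simp: box_adj_def)
    with step.IH show ?case by (elim disjE) auto
  qed simp
  then show ?thesis by simp
qed

text \<open>Connectedness makes the vertical distance of two boxes in one column even, so it is at
  least 2. Convexity then fills in a 2x2 square, which a ribbon excludes.\<close>

lemma ribbon_column_unique:
  assumes "ribbon B" "(x, y) \<in> B" "(x, y') \<in> B"
  shows "y = y'"
proof -
  have False if xy: "(x, y) \<in> B" "(x, y') \<in> B" "y < y'" for y y'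
  proof -
    have conv: "c \<in> B" if "box_le (x, y) c" "box_le c (x, y')" for c
      using assms(1) xy that unfolding ribbon_def skew_shape_def by blast
    have ev: "even (y' - y)"
      using connected_boxes_parity[of B x y x y'] assms(1) xy unfolding ribbon_def by simp
    have "y' - y \<noteq> 1" using ev by presburger
    then have "y + 2 \<le> y'" using xy(3) by linarith
    then have "{(x, y), (x - 1, y + 1), (x + 1, y + 1), (x, y + 2)} \<subseteq> B"
      using ev xy by (auto intro!: conv simp: box_le_def)
    then show False using assms(1) unfolding ribbon_def by blast
  qed
  then show ?thesis using assms(2,3) by (meson linorder_neqE)
qed

text \<open>Between the two end boxes every column is met, because adjacent boxes lie in
  neighbouring columns, and it is met once, because the tile is a ribbon.\<close>

lemma dyck_tileE:
  assumes "dyck_tile B"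
  obtains a b h where "dyck_arc a b h" "B = graph_on a b h"
proof -
  obtain a b m where ab: "(a, m) \<in> B" "(b, m) \<in> B"
    and bd: "\<And>x y. (x, y) \<in> B \<Longrightarrow> a \<le> x \<and> x \<le> b \<and> m \<le> y"
    using assms unfolding dyck_tile_def by blast
  have rib: "ribbon B" and con: "connected_boxes B"
    using assms unfolding dyck_tile_def ribbon_def by auto
  define h where "h x = (THE y. (x, y) \<in> B)" for x
  have h: "h x = y" if "(x, y) \<in> B" for x y
    unfolding h_def using that ribbon_column_unique[OF rib] by blast
  have step: "(x, h x) \<in> B \<and> (x + 1, h (x + 1)) \<in> B \<and> \<bar>h (x + 1) - h x\<bar> = 1"
    if "a \<le> x" "x < b" for x
    using connected_boxes_crossing[OF con ab, of x] that h by auto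
  have le: "a \<le> b" using bd[OF ab(1)] by simp
  have mem: "(x, h x) \<in> B" if "a \<le> x" "x \<le> b" for x
    using step[of x] that ab(2) h[OF ab(2)] by (cases "x = b") auto
  have "B = graph_on a b h"
  proof (rule set_eqI)
    fix p show "p \<in> B \<longleftrightarrow> p \<in> graph_on a b h"
      using mem bd h by (cases p) (auto simp: mem_graph_on)
  qed
  moreover have "dyck_arc a b h"
  proof (rule dyck_arcI)
    fix x assume "a \<le> x" "x < b"
    then show "h (x + 1) = h x + 1 \<or> h (x + 1) = h x - 1" using step[of x] by linarith
  next
    fix x assume "a \<le> x" "x \<le> b"
    then show "h a \<le> h x" using bd[OF mem[of x]] h[OF ab(1)] by simp
  qed (use le h ab in auto)
  ultimately show ?thesis using that by blast
qed

lemma dyck_tile_spread: "dyck_tile (spread s t) \<longleftrightarrow> dyck_tile t"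
proof
  assume "dyck_tile t"
  then obtain a b h where "dyck_arc a b h" "t = graph_on a b h" by (rule dyck_tileE)
  then show "dyck_tile (spread s t)"
    using dyck_tile_graph_on[of "left_end s a" "right_end s b" "lift_height s h"]
    by (simp add: spread_graph_on dyck_arc_lift)
next
  assume "dyck_tile (spread s t)"
  then obtain a' b' h' where arc: "dyck_arc a' b' h'" and t: "spread s t = graph_on a' b' h'"
    by (rule dyck_tileE)
  obtain a b h where ab: "left_end s a = a'" "right_end s b = b'"
    and eq: "graph_on a' b' h' = graph_on a' b' (lift_height s h)"
    using peaked_graph_on[of s a' b' h'] peaked_spread[of s t] dyck_arcD(1)[OF arc] unfolding t by blast
  have "dyck_arc (left_end s a) (right_end s b) (lift_height s h)"
    using arc dyck_arc_cong[OF eq] ab by simp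
  then have "dyck_arc a b h" unfolding dyck_arc_lift .
  moreover have "spread s t = spread s (graph_on a b h)"
    unfolding spread_graph_on t eq using ab by simp
  then have "t = graph_on a b h" by (simp add: spread_eq_iff)
  ultimately show "dyck_tile t" using dyck_tile_graph_on by simp
qed

lemma dyck_tiling_spread:
  assumes "- int n \<le> s" "s \<le> int n"
  shows "dyck_tiling (Suc n) (spread_tiling s T) \<longleftrightarrow> dyck_tiling n T"
  unfolding dyck_tiling_def spread_tiling_def
  by (simp add: dyck_path_spread[OF assms] weakly_above_spread skew_boxes_spread
      partition_on_spread dyck_tile_spread)

section \<open>Adding and removing one-box tiles\<close>

text \<open>Height functions for the two boundaries turn membership of a box in the skew shape into
  inequalities and a parity condition. Outside the columns from \<open>- int m\<close> to
  \<open>int m\<close> their values are arbitrary, so range conditions recur below.\<close>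

locale ci_tiling =
  fixes m :: nat and T :: tiling and hl hu :: "int \<Rightarrow> int"
  assumes lower: "lower T = graph_on (- int m) (int m) hl"
    and upper: "upper T = graph_on (- int m) (int m) hu"
    and lower_arc: "dyck_arc (- int m) (int m) hl"
    and upper_arc: "dyck_arc (- int m) (int m) hu"
    and hl_left: "hl (- int m) = 0"
    and hu_left: "hu (- int m) = 0"
    and hl_le_hu: "- int m \<le> x \<Longrightarrow> x \<le> int m \<Longrightarrow> hl x \<le> hu x"
    and tiles_partition: "partition_on (skew_boxes (lower T) (upper T)) (tiles T)"
    and tiles_dyck: "t \<in> tiles T \<Longrightarrow> dyck_tile t"
    and inclusive: "cover_inclusive T"

lemma ci_tiling_iff:
  "dyck_tiling m T \<and> cover_inclusive T \<longleftrightarrow> (\<exists>hl hu. ci_tiling m T hl hu)"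
proof
  assume *: "dyck_tiling m T \<and> cover_inclusive T"
  then obtain hl hu where h: "dyck_arc (- int m) (int m) hl" "hl (- int m) = 0"
    "lower T = graph_on (- int m) (int m) hl"
    "dyck_arc (- int m) (int m) hu" "hu (- int m) = 0"
    "upper T = graph_on (- int m) (int m) hu"
    unfolding dyck_tiling_def dyck_path_iff by blast
  have "hl x \<le> hu x" if "- int m \<le> x" "x \<le> int m" for x
    using * that unfolding dyck_tiling_def weakly_above_def h mem_graph_on by blast
  then have "ci_tiling m T hl hu"
    using * h unfolding dyck_tiling_def by unfold_locales auto
  then show "\<exists>hl hu. ci_tiling m T hl hu" by blast
next
  assume "\<exists>hl hu. ci_tiling m T hl hu"
  then obtain hl hu where "ci_tiling m T hl hu" by blast
  then interpret ci_tiling m T hl hu .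
  show "dyck_tiling m T \<and> cover_inclusive T"
    unfolding dyck_tiling_def dyck_path_iff
  proof (intro conjI)
    show "weakly_above (upper T) (lower T)"
      unfolding weakly_above_def lower upper mem_graph_on using hl_le_hu by auto
  qed (use lower_arc upper_arc hl_left hu_left lower upper tiles_partition tiles_dyck inclusive in blast)+
qed

context ci_tiling
begin

lemma hl_right: "hl (int m) = 0" and hu_right: "hu (int m) = 0"
  using dyck_arcD(3)[OF lower_arc] dyck_arcD(3)[OF upper_arc] hl_left hu_left by simp_all

lemma hl_nonneg: "- int m \<le> x \<Longrightarrow> x \<le> int m \<Longrightarrow> 0 \<le> hl x"
  and hu_nonneg: "- int m \<le> x \<Longrightarrow> x \<le> int m \<Longrightarrow> 0 \<le> hu x"
  using dyck_arcD(4)[OF lower_arc] dyck_arcD(4)[OF upper_arc] hl_left hu_left by simp_all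

lemma hl_step: "- int m \<le> x \<Longrightarrow> x < int m \<Longrightarrow> hl (x + 1) = hl x + 1 \<or> hl (x + 1) = hl x - 1"
  and hu_step: "- int m \<le> x \<Longrightarrow> x < int m \<Longrightarrow> hu (x + 1) = hu x + 1 \<or> hu (x + 1) = hu x - 1"
  using dyck_arcD(2)[OF lower_arc] dyck_arcD(2)[OF upper_arc] by simp_all

lemma hu_step': "- int m < x \<Longrightarrow> x \<le> int m \<Longrightarrow> hu x = hu (x - 1) + 1 \<or> hu x = hu (x - 1) - 1"
  using hu_step[of "x - 1"] by simp

lemma parity_hl:
  assumes "- int m \<le> x" "x \<le> int m"
  shows "even (hl x - (x + int m))"
  using dyck_arc_parity[OF lower_arc _ assms] hl_left by simp

lemma parity_hu:
  assumes "- int m \<le> x" "x \<le> int m"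
  shows "even (hu x - (x + int m))"
  using dyck_arc_parity[OF upper_arc _ assms] hu_left by simp

lemma parity_diff: "- int m \<le> x \<Longrightarrow> x \<le> int m \<Longrightarrow> even (hu x - hl x)"
  using parity_hl[of x] parity_hu[of x] by presburger

lemma mem_skew:
  "(x, y) \<in> skew_boxes (lower T) (upper T) \<longleftrightarrow>
    - int m \<le> x \<and> x \<le> int m \<and> hl x \<le> y \<and> y + 2 \<le> hu x \<and> even (y - hl x)"
  unfolding skew_boxes_def lower upper mem_graph_on by auto

lemma mem_tile_skew: "(x, y) \<in> t \<Longrightarrow> t \<in> tiles T \<Longrightarrow>
    - int m \<le> x \<and> x \<le> int m \<and> hl x \<le> y \<and> y + 2 \<le> hu x \<and> even (y - hl x)"
  using tiles_partition mem_skew[of x y] unfolding partition_on_def by blast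

lemma ex_tile:
  assumes "- int m \<le> x" "x \<le> int m" "hl x \<le> y" "y + 2 \<le> hu x" "even (y - hl x)"
  obtains t where "t \<in> tiles T" "(x, y) \<in> t"
  using tiles_partition mem_skew[of x y] assms unfolding partition_on_def by blast

lemma tile_unique: "p \<in> t \<Longrightarrow> p \<in> t' \<Longrightarrow> t \<in> tiles T \<Longrightarrow> t' \<in> tiles T \<Longrightarrow> t = t'"
  using tiles_partition unfolding partition_on_def disjoint_def by blast

lemma tile_column_unique: "(x, y) \<in> t \<Longrightarrow> (x, y') \<in> t \<Longrightarrow> t \<in> tiles T \<Longrightarrow> y = y'"
  using tiles_dyck ribbon_column_unique unfolding dyck_tile_def by blast

lemma top_box_le:
  assumes "{(x, hu x - 2)} \<in> tiles T"
  shows "- int m < x" "x < int m" "hl x + 2 \<le> hu x"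
proof -
  show *: "hl x + 2 \<le> hu x" using mem_tile_skew[of x "hu x - 2", OF _ assms] by simp
  have x: "- int m \<le> x" "x \<le> int m" using mem_tile_skew[of x "hu x - 2", OF _ assms] by simp_all
  have "x \<noteq> - int m" using * hl_left hu_left by auto
  moreover have "x \<noteq> int m" using * hl_right hu_right by auto
  ultimately show "- int m < x" "x < int m" using x by auto
qed

lemma eligible_iff:
  "eligible T x \<longleftrightarrow> - int m < x \<and> x \<le> int m \<and> hu x = hu (x - 1) + 1 \<and> {(x, hu x - 2)} \<notin> tiles T"
  unfolding eligible_def upper mem_graph_on by auto

lemma finite_eligible: "finite {x. eligible T x}"
  by (rule finite_subset[of _ "{- int m..int m}"]) (auto simp: eligible_iff)

lemma special_column_eq:
  assumes "eligible T s" "\<And>x. x > s \<Longrightarrow> \<not> eligible T x"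
  shows "special_column T = s"
  unfolding special_column_def using assms finite_eligible
  by (intro Max_eqI) (auto simp: leI, meson leI)

lemma special_column_properties:
  assumes "m > 0"
  defines "s \<equiv> special_column T"
  shows "- int m < s" "s < int m" "hu s = hu (s - 1) + 1" "{(s, hu s - 2)} \<notin> tiles T"
    "\<And>x. s < x \<Longrightarrow> x \<le> int m \<Longrightarrow> hu x = hu (x - 1) + 1 \<Longrightarrow> {(x, hu x - 2)} \<in> tiles T"
proof -
  \<comment> \<open>The first step of the upper path goes up, and no box fits below its end at
    height 1. Hence some column is always eligible and the maximum is taken over a nonempty
    set.\<close>
  have "hu (- int m + 1) = 1"
    using hu_step[of "- int m"] hu_nonneg[of "- int m + 1"] assms hu_left by auto
  moreover have "{(- int m + 1, - 1)} \<notin> tiles T"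
    using hl_nonneg[of "- int m + 1"] assms mem_tile_skew[of "- int m + 1" "- 1" "{(- int m + 1, - 1)}"] by auto
  ultimately have "eligible T (- int m + 1)"
    using assms hu_left by (simp add: eligible_iff)
  then have "s \<in> {x. eligible T x}"
    unfolding s_def special_column_def using finite_eligible by (intro Max_in) auto
  then have s: "- int m < s \<and> s \<le> int m \<and> hu s = hu (s - 1) + 1 \<and> {(s, hu s - 2)} \<notin> tiles T"
    unfolding mem_Collect_eq eligible_iff .
  then show "- int m < s" "hu s = hu (s - 1) + 1" by simp_all
  show "{(s, hu s - 2)} \<notin> tiles T" using s by blast
  \<comment> \<open>An up step ending at height 0 would start at a negative height.\<close>
  have "s \<noteq> int m" using s hu_right hu_nonneg[of "s - 1"] by auto
  then show "s < int m" using s by auto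
  fix x assume x: "s < x" "x \<le> int m" "hu x = hu (x - 1) + 1"
  have "\<not> eligible T x"
    using x(1) Max_ge[OF finite_eligible, of x] unfolding s_def special_column_def by auto
  then show "{(x, hu x - 2)} \<in> tiles T" using x s by (simp add: eligible_iff)
qed

end

lemma point_set_eqI: "(\<And>x y. (x, y) \<in> P \<longleftrightarrow> (x, y) \<in> Q) \<Longrightarrow> P = Q"
  by auto

definition remove_boxes :: "point set \<Rightarrow> tiling \<Rightarrow> tiling" where
  "remove_boxes B T =
    T\<lparr>upper := (upper T - {(x, y + 2) | x y. (x, y) \<in> B}) \<union> B,
      tiles := tiles T - {{b} | b. b \<in> B}\<rparr>"

lemma singleton_dyck_tile: "dyck_tile {p}"
  using dyck_tile_graph_on[of "fst p" "fst p" "\<lambda>_. snd p"]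
proof -
  have "graph_on (fst p) (fst p) (\<lambda>_. snd p) = {p}" by (cases p) (auto simp: graph_on_def)
  then show ?thesis
    using dyck_tile_graph_on[of "fst p" "fst p" "\<lambda>_. snd p"] by (simp add: dyck_arc_def)
qed

context ci_tiling
begin

context
  fixes k :: "int \<Rightarrow> int" and B :: "point set"
  assumes k_arc: "dyck_arc (- int m) (int m) k"
begin

text \<open>Cover-inclusiveness survives since a new box lies on the old upper path: no old tile can
  cover it, and whatever it covers contains its single column. The function \<open>k\<close> is the
  new upper height.\<close>

lemma ci_tiling_add_boxes:
  assumes k: "\<And>x. k x = hu x \<or> k x = hu x + 2"
    and B: "\<And>x y. (x, y) \<in> B \<longleftrightarrow> - int m \<le> x \<and> x \<le> int m \<and> y = hu x \<and> k x = hu x + 2"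
    and k_left: "k (- int m) = 0"
  shows "ci_tiling m (add_boxes B T) hl k" and "remove_boxes B (add_boxes B T) = T"
proof -
  have up: "upper (add_boxes B T) = graph_on (- int m) (int m) k"
  proof -
    have "(x, y) \<in> upper (add_boxes B T) \<longleftrightarrow> (x, y) \<in> graph_on (- int m) (int m) k" for x y
    proof -
      have "(x, y) \<in> upper (add_boxes B T) \<longleftrightarrow> (x, y) \<in> upper T \<and> (x, y) \<notin> B \<or> (x, y - 2) \<in> B"
        unfolding add_boxes_def by (auto intro: exI[of _ "y - 2"])
      then show ?thesis unfolding B upper mem_graph_on using k[of x] by (smt (verit))
    qed
    then show ?thesis by auto
  qed
  have skew: "skew_boxes (lower (add_boxes B T)) (upper (add_boxes B T)) = skew_boxes (lower T) (upper T) \<union> B"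
  proof -
    have "(x, y) \<in> skew_boxes (lower (add_boxes B T)) (upper (add_boxes B T)) \<longleftrightarrow>
      (x, y) \<in> skew_boxes (lower T) (upper T) \<or> (x, y) \<in> B" for x y
    proof -
      have l: "lower (add_boxes B T) = graph_on (- int m) (int m) hl" by (simp add: add_boxes_def lower)
      have 1: "(x, y) \<in> skew_boxes (lower (add_boxes B T)) (upper (add_boxes B T)) \<longleftrightarrow>
         - int m \<le> x \<and> x \<le> int m \<and> hl x \<le> y \<and> y + 2 \<le> k x \<and> even (y - hl x)"
        unfolding skew_boxes_def l up mem_graph_on by auto
      show ?thesis
      proof (cases "- int m \<le> x \<and> x \<le> int m")
        case True
        then have "even (hu x - hl x)" "hl x \<le> hu x" using parity_diff hl_le_hu by auto
        \<comment> \<open>Boxes of a column sit at heights of one parity, so raising the boundary by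
          2 admits exactly the box at height \<open>hu x\<close>.\<close>
        moreover have "y + 2 \<le> hu x + 2 \<longleftrightarrow> y + 2 \<le> hu x \<or> y = hu x" if "even (y - hl x)"
          using that calculation by presburger
        ultimately show ?thesis unfolding 1 mem_skew B using True k[of x] by auto
      next
        case False
        then show ?thesis unfolding 1 mem_skew B by auto
      qed
    qed
    then show ?thesis by auto
  qed
  have disj: "p \<notin> t" if "p \<in> B" "t \<in> tiles T" for p t
    using that mem_tile_skew[of "fst p" "snd p" t] B[of "fst p" "snd p"] by auto
  have sing: "partition_on B {{b} | b. b \<in> B}"
    by (auto simp: partition_on_def disjoint_def)
  have tl: "tiles (add_boxes B T) = tiles T \<union> {{b} | b. b \<in> B}" by (simp add: add_boxes_def)
  show "ci_tiling m (add_boxes B T) hl k"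
  proof
    show "lower (add_boxes B T) = graph_on (- int m) (int m) hl" by (simp add: add_boxes_def lower)
    show "- int m \<le> x \<Longrightarrow> x \<le> int m \<Longrightarrow> hl x \<le> k x" for x
      using hl_le_hu[of x] k[of x] by auto
    have "skew_boxes (lower T) (upper T) \<inter> B = {}" using B mem_skew by auto
    then show "partition_on (skew_boxes (lower (add_boxes B T)) (upper (add_boxes B T))) (tiles (add_boxes B T))"
      unfolding skew tl using tiles_partition sing
      by (simp add: partition_on_def disjoint_union)
    show "t \<in> tiles (add_boxes B T) \<Longrightarrow> dyck_tile t" for t
      unfolding tl using tiles_dyck singleton_dyck_tile by auto
    show "cover_inclusive (add_boxes B T)"
      unfolding cover_inclusive_def
    proof (intro ballI impI)
      fix A C assume AC: "A \<in> tiles (add_boxes B T)" "C \<in> tiles (add_boxes B T)" "covers A C"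
      then obtain x y where xy: "(x, y) \<in> C" "(x, y + 2) \<in> A" by (auto simp: covers_def)
      show "fst ` A \<subseteq> fst ` C"
      proof (cases "A \<in> tiles T")
        case True
        have "C \<in> tiles T"
        proof (rule ccontr)
          assume "C \<notin> tiles T"
          then have "(x, y) \<in> B" using AC(2) xy(1) unfolding tl by auto
          then show False using mem_tile_skew[OF xy(2) True] B[of x y] by auto
        qed
        then show ?thesis using inclusive True AC(3) unfolding cover_inclusive_def by blast
      next
        case False
        then have "A = {(x, y + 2)}" using AC(1) xy(2) unfolding tl by auto
        then show ?thesis using xy(1) by force
      qed
    qed
  qed (fact up lower_arc hl_left k_arc k_left)+
  show "remove_boxes B (add_boxes B T) = T"
  proof -
    have "(upper (add_boxes B T) - {(x, y + 2) | x y. (x, y) \<in> B}) \<union> B = upper T"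
    proof -
      have "(x, y) \<in> (upper (add_boxes B T) - {(x, y + 2) | x y. (x, y) \<in> B}) \<union> B \<longleftrightarrow> (x, y) \<in> upper T" for x y
      proof -
        have "(x, y) \<in> {(x, y + 2) | x y. (x, y) \<in> B} \<longleftrightarrow> (x, y - 2) \<in> B" by (auto intro: exI[of _ "y - 2"])
        then show ?thesis unfolding up upper Un_iff Diff_iff mem_graph_on B using k[of x] by (smt (verit))
      qed
      then show ?thesis by (rule point_set_eqI)
    qed
    moreover have "tiles (add_boxes B T) - {{b} | b. b \<in> B} = tiles T"
      unfolding tl using disj by auto
    moreover have "lower (add_boxes B T) = lower T" by (simp add: add_boxes_def)
    ultimately show ?thesis by (simp add: remove_boxes_def)
  qed
qed

text \<open>The removed boxes are entire tiles at the top of their columns, so the other tiles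
  partition what remains, and a subset of the tiles inherits cover-inclusiveness.\<close>

lemma ci_tiling_remove_boxes:
  assumes k: "\<And>x. k x = hu x \<or> k x = hu x - 2 \<and> {(x, hu x - 2)} \<in> tiles T"
    and B: "\<And>x y. (x, y) \<in> B \<longleftrightarrow> - int m \<le> x \<and> x \<le> int m \<and> y = k x \<and> k x = hu x - 2"
  shows "ci_tiling m (remove_boxes B T) hl k" and "add_boxes B (remove_boxes B T) = T"
proof -
  have shift: "(x, y) \<in> {(x, y + 2) | x y. (x, y) \<in> B} \<longleftrightarrow> (x, y - 2) \<in> B" for x y
    by (auto intro: exI[of _ "y - 2"])
  have Bt: "{p} \<in> tiles T" if "p \<in> B" for p
    using that B[of "fst p" "snd p"] k[of "fst p"] by (cases p) auto
  have tl: "tiles (remove_boxes B T) = tiles T - {{b} | b. b \<in> B}" by (simp add: remove_boxes_def)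
  have up: "upper (remove_boxes B T) = graph_on (- int m) (int m) k"
  proof -
    have "(x, y) \<in> upper (remove_boxes B T) \<longleftrightarrow> (x, y) \<in> graph_on (- int m) (int m) k" for x y
    proof -
      have "(x, y) \<in> upper (remove_boxes B T) \<longleftrightarrow> (x, y) \<in> upper T \<and> (x, y - 2) \<notin> B \<or> (x, y) \<in> B"
        unfolding shift[symmetric] by (simp add: remove_boxes_def)
      then show ?thesis unfolding B upper mem_graph_on using k[of x] by (smt (verit))
    qed
    then show ?thesis by auto
  qed
  have disj: "b \<notin> t" if "b \<in> B" "t \<in> tiles (remove_boxes B T)" for b t
  proof
    assume "b \<in> t"
    then have "t = {b}" using that Bt[OF that(1)] tile_unique[of b t "{b}"] unfolding tl by blast
    then show False using that unfolding tl by blast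
  qed
  have Bs: "B \<subseteq> skew_boxes (lower T) (upper T)"
    using Bt tiles_partition unfolding partition_on_def by auto
  have skew: "skew_boxes (lower (remove_boxes B T)) (upper (remove_boxes B T)) = skew_boxes (lower T) (upper T) - B"
  proof -
    have "(x, y) \<in> skew_boxes (lower (remove_boxes B T)) (upper (remove_boxes B T)) \<longleftrightarrow>
      (x, y) \<in> skew_boxes (lower T) (upper T) \<and> (x, y) \<notin> B" for x y
    proof -
      have l: "lower (remove_boxes B T) = graph_on (- int m) (int m) hl" by (simp add: remove_boxes_def lower)
      have 1: "(x, y) \<in> skew_boxes (lower (remove_boxes B T)) (upper (remove_boxes B T)) \<longleftrightarrow>
         - int m \<le> x \<and> x \<le> int m \<and> hl x \<le> y \<and> y + 2 \<le> k x \<and> even (y - hl x)"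
        unfolding skew_boxes_def l up mem_graph_on by auto
      show ?thesis
      proof (cases "- int m \<le> x \<and> x \<le> int m")
        case True
        then have "even (hu x - hl x)" using parity_diff by auto
        then have "y + 2 \<le> hu x - 2 \<longleftrightarrow> y + 2 \<le> hu x \<and> y \<noteq> hu x - 2" if "even (y - hl x)"
          using that by presburger
        then show ?thesis unfolding 1 mem_skew B using True k[of x] by auto
      next
        case False
        then show ?thesis unfolding 1 mem_skew B by auto
      qed
    qed
    then show ?thesis by auto
  qed
  show "ci_tiling m (remove_boxes B T) hl k"
  proof
    show "lower (remove_boxes B T) = graph_on (- int m) (int m) hl" by (simp add: remove_boxes_def lower)
    show "- int m \<le> x \<Longrightarrow> x \<le> int m \<Longrightarrow> hl x \<le> k x" for x
      using hl_le_hu[of x] k[of x] top_box_le(3)[of x] by auto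
    have "\<Union> (tiles (remove_boxes B T)) = \<Union> (tiles T) - B"
    proof
      show "\<Union> (tiles (remove_boxes B T)) \<subseteq> \<Union> (tiles T) - B" using disj tl by blast
      show "\<Union> (tiles T) - B \<subseteq> \<Union> (tiles (remove_boxes B T))" unfolding tl by auto
    qed
    then show "partition_on (skew_boxes (lower (remove_boxes B T)) (upper (remove_boxes B T))) (tiles (remove_boxes B T))"
      using tiles_partition unfolding skew partition_on_def disjoint_def tl by auto
    show "t \<in> tiles (remove_boxes B T) \<Longrightarrow> dyck_tile t" for t
      unfolding tl using tiles_dyck by auto
    show "cover_inclusive (remove_boxes B T)"
      using inclusive unfolding cover_inclusive_def tl by auto
    \<comment> \<open>The outermost column contains no box, so nothing is removed there.\<close>
    show "k (- int m) = 0"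
      using k[of "- int m"] top_box_le(1)[of "- int m"] hu_left by auto
  qed (fact up lower_arc hl_left k_arc)+
  show "add_boxes B (remove_boxes B T) = T"
  proof -
    have "(upper (remove_boxes B T) - B) \<union> {(x, y + 2) | x y. (x, y) \<in> B} = upper T"
    proof -
      have "(x, y) \<in> (upper (remove_boxes B T) - B) \<union> {(x, y + 2) | x y. (x, y) \<in> B} \<longleftrightarrow> (x, y) \<in> upper T" for x y
      proof -
        have "k x = hu x \<or> k x = hu x - 2" using k[of x] by blast
        then show ?thesis
          unfolding Un_iff Diff_iff shift unfolding up upper mem_graph_on B by (elim disjE) (simp, arith)
      qed
      then show ?thesis by (rule point_set_eqI)
    qed
    moreover have "tiles (remove_boxes B T) \<union> {{b} | b. b \<in> B} = tiles T"
      unfolding tl using Bt by auto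
    moreover have "lower (remove_boxes B T) = lower T" by (simp add: remove_boxes_def)
    ultimately show ?thesis by (simp add: add_boxes_def)
  qed
qed

end

end

section \<open>Peaked tilings and growth maps\<close>

text \<open>These conditions single out the spreads at \<open>s\<close> among the tilings of
  positive order: \<open>peak_tiling_spread\<close> shows that spreads satisfy them,
  \<open>ex_spread\<close> shows the converse.\<close>

locale peak_tiling = ci_tiling +
  fixes s :: int
  assumes s_bounds: "- int m < s" "s < int m"
    and up_step: "hu s = hu (s - 1) + 1"
    and down_step: "hu (s + 1) = hu s - 1"
    and no_top_box: "{(s, hu s - 2)} \<notin> tiles T"
begin

text \<open>The upper path descends on both sides of \<open>s\<close>, so the tile can continue from
  its box in column \<open>s\<close> only downwards. Not being a single box it does continue on some
  side, and since both its ends are at its minimal height, column \<open>s\<close> is neither of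
  them.\<close>

lemma tile_top:
  assumes t: "t \<in> tiles T" "(s, hu s - 2) \<in> t"
  shows "(s - 1, hu s - 3) \<in> t \<and> (s + 1, hu s - 3) \<in> t"
proof -
  obtain a b h where arc: "dyck_arc a b h" and g: "t = graph_on a b h"
    using dyck_tileE[OF tiles_dyck[OF t(1)]] .
  have s: "a \<le> s" "s \<le> b" "h s = hu s - 2" using t(2) unfolding g mem_graph_on by auto
  have right: "h (s + 1) = h s - 1" if "s < b"
  proof -
    have "(s + 1, h (s + 1)) \<in> t" using s that unfolding g mem_graph_on by simp
    then have "h (s + 1) + 2 \<le> hu (s + 1)" using mem_tile_skew[OF _ t(1)] by blast
    then show ?thesis using dyck_arcD(2)[OF arc, of s] s that down_step by auto
  qed
  have left: "h (s - 1) = h s - 1" if "a < s"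
  proof -
    have "(s - 1, h (s - 1)) \<in> t" using s that unfolding g mem_graph_on by simp
    then have "h (s - 1) + 2 \<le> hu (s - 1)" using mem_tile_skew[OF _ t(1)] by blast
    then show ?thesis using dyck_arcD(2)[OF arc, of "s - 1"] s that up_step by auto
  qed
  have "t \<noteq> {(s, hu s - 2)}" using t(1) no_top_box by auto
  moreover have "t = {(s, hu s - 2)}" if "a = s" "b = s"
    using s that unfolding g graph_on_def by auto
  ultimately consider "a < s" | "s < b" using s by linarith
  then have "a < s \<and> s < b"
  proof cases
    case 1
    have "s \<noteq> b" using left[OF 1] dyck_arcD(3)[OF arc] dyck_arcD(4)[OF arc, of "s - 1"] s 1 by auto
    with 1 s show ?thesis by simp
  next
    case 2
    have "s \<noteq> a" using right[OF 2] dyck_arcD(4)[OF arc, of "s + 1"] s 2 by auto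
    with 2 s show ?thesis by simp
  qed
  then show ?thesis using left right s unfolding g mem_graph_on by simp
qed

text \<open>Going down column \<open>s\<close>, cover-inclusiveness hands the peak over from each tile to the next.\<close>

lemma tile_peak_aux:
  assumes "t \<in> tiles T" "(s, hu s - 2 - 2 * int j) \<in> t"
  shows "(s - 1, hu s - 3 - 2 * int j) \<in> t \<and> (s + 1, hu s - 3 - 2 * int j) \<in> t"
  using assms
proof (induction j arbitrary: t)
  case 0
  then show ?case using tile_top by simp
next
  case (Suc j)
  let ?y = "hu s - 2 - 2 * int j"
  have y: "(s, ?y - 2) \<in> t" using Suc.prems(2) by (simp add: algebra_simps)
  have "hl s \<le> ?y - 2" "even (?y - 2 - hl s)" using mem_tile_skew[OF y Suc.prems(1)] by auto
  then obtain t' where t': "t' \<in> tiles T" "(s, ?y) \<in> t'"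
    using ex_tile[of s ?y] s_bounds by auto
  have peak: "(s - 1, ?y - 1) \<in> t'" "(s + 1, ?y - 1) \<in> t'"
    using Suc.IH[OF t'] by (simp_all add: algebra_simps)
  have "covers t' t" unfolding covers_def using t'(2) by (intro bexI[OF _ y]) (simp add: algebra_simps)
  then have sub: "fst ` t' \<subseteq> fst ` t"
    using inclusive t'(1) Suc.prems(1) unfolding cover_inclusive_def by blast
  have ne: "t \<noteq> t'" using tile_column_unique[OF y _ Suc.prems(1), of ?y] t'(2) by auto
  obtain a b h where arc: "dyck_arc a b h" and g: "t = graph_on a b h"
    using dyck_tileE[OF tiles_dyck[OF Suc.prems(1)]] .
  have hs: "h s = ?y - 2" using y unfolding g mem_graph_on by simp
  have neigh: "h x = ?y - 3" if "x = s - 1 \<or> x = s + 1" for x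
  proof -
    have x': "(x, ?y - 1) \<in> t'" using that peak by auto
    then have "x \<in> fst ` t" using sub by force
    then have "a \<le> x" "x \<le> b" unfolding g graph_on_def by auto
    then have xt: "(x, h x) \<in> t" unfolding g mem_graph_on by simp
    \<comment> \<open>The box at this height already belongs to the tile \<open>t'\<close> above.
      The only other unit step from column \<open>s\<close> goes down.\<close>
    have "h x \<noteq> ?y - 1"
      using ne x' xt tile_unique[of "(x, ?y - 1)" t t'] t'(1) Suc.prems(1) by auto
    moreover have "h x = h s - 1 \<or> h x = h s + 1"
      using that dyck_arcD(2)[OF arc, of s] dyck_arcD(2)[OF arc, of "s - 1"] \<open>a \<le> x\<close> \<open>x \<le> b\<close>
        y unfolding g mem_graph_on by auto
    ultimately show ?thesis using hs by auto
  qed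
  have "a \<le> s - 1" "s + 1 \<le> b"
  proof -
    have "s - 1 \<in> fst ` t" "s + 1 \<in> fst ` t" using sub peak by force+
    then show "a \<le> s - 1" "s + 1 \<le> b" unfolding g graph_on_def by auto
  qed
  then show ?case
    using neigh[of "s - 1"] neigh[of "s + 1"] unfolding g mem_graph_on by auto
qed

lemma tile_peak:
  assumes "t \<in> tiles T" "(s, y) \<in> t"
  shows "(s - 1, y - 1) \<in> t" "(s + 1, y - 1) \<in> t"
proof -
  have y: "hl s \<le> y" "y + 2 \<le> hu s" "even (y - hl s)" using mem_tile_skew[OF assms(2,1)] by auto
  have "even (hu s - hl s)" using parity_diff s_bounds by simp
  with y have ev: "even (hu s - 2 - y)" by presburger
  then obtain i where i: "hu s - 2 - y = 2 * i" by blast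
  with y have "i = int (nat i)" by simp
  with i have "y = hu s - 2 - 2 * int (nat i)" by simp
  moreover from this have "y - 1 = hu s - 3 - 2 * int (nat i)" by linarith
  ultimately show "(s - 1, y - 1) \<in> t" "(s + 1, y - 1) \<in> t"
    using tile_peak_aux[of t "nat i"] assms by metis+
qed

text \<open>Either the two paths touch in column \<open>s\<close>, and the lower one is squeezed
  under the peak of the upper one, or the lowest tile in column \<open>s\<close> has boxes at height
  \<open>hl s - 1\<close> on both sides, which lie on or above the lower path.\<close>

lemma lower_peak: "hl (s - 1) = hl s - 1" "hl (s + 1) = hl s - 1"
proof -
  have le: "hl (s - 1) \<le> hl s - 1 \<and> hl (s + 1) \<le> hl s - 1"
  proof (cases "hl s = hu s")
    case True
    then show ?thesis
      using hl_le_hu[of "s - 1"] hl_le_hu[of "s + 1"] up_step down_step s_bounds by auto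
  next
    case False
    have "even (hu s - hl s)" "hl s \<le> hu s" using parity_diff hl_le_hu s_bounds by auto
    with False have "hl s + 2 \<le> hu s" by presburger
    then obtain t where t: "t \<in> tiles T" "(s, hl s) \<in> t"
      using ex_tile[of s "hl s"] s_bounds by auto
    show ?thesis
      using mem_tile_skew[OF tile_peak(1)[OF t] t(1)] mem_tile_skew[OF tile_peak(2)[OF t] t(1)] by simp
  qed
  show "hl (s - 1) = hl s - 1" "hl (s + 1) = hl s - 1"
    using le hl_step[of s] hl_step[of "s - 1"] s_bounds by auto
qed

lemma peaked_boundary: "peaked s (lower T)" "peaked s (upper T)"
  using s_bounds lower_peak up_step down_step
  unfolding peaked_def lower upper mem_graph_on by auto

text \<open>The peaks of both boundaries guarantee a box in column \<open>s\<close> just above any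
  box of column \<open>s - 1\<close> or \<open>s + 1\<close>. Its tile comes down on both sides of
  \<open>s\<close> and so contains the given box; by disjointness it is the given tile.\<close>

lemma peaked_tile:
  assumes t: "t \<in> tiles T"
  shows "peaked s t"
proof -
  have "(s, y + 1) \<in> t" if "(x, y) \<in> t" "x = s - 1 \<or> x = s + 1" for x y
  proof -
    have y: "hl x \<le> y" "y + 2 \<le> hu x" "even (y - hl x)" using mem_tile_skew[OF that(1) t] by auto
    have "hl x = hl s - 1" "hu x = hu s - 1" using that(2) lower_peak up_step down_step by auto
    with y have "hl s \<le> y + 1" "y + 1 + 2 \<le> hu s" "even (y + 1 - hl s)" by auto
    then obtain t' where t': "t' \<in> tiles T" "(s, y + 1) \<in> t'"
      using ex_tile[of s "y + 1"] s_bounds by auto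
    then have "(x, y) \<in> t'" using tile_peak[OF t'] that(2) by auto
    then show ?thesis using tile_unique[OF _ that(1)] t' t by blast
  qed
  then show ?thesis unfolding peaked_def using tile_peak[OF t, of "_ + 1"] by auto
qed

lemma ex_spread: "\<exists>T'. T = spread_tiling s T'"
proof -
  let ?T' = "\<lparr>lower = squeeze s ` lower T, upper = squeeze s ` upper T,
    tiles = (\<lambda>t. squeeze s ` t) ` tiles T\<rparr>"
  have "spread s ` (\<lambda>t. squeeze s ` t) ` tiles T = (\<lambda>t. t) ` tiles T"
    unfolding image_image by (rule image_cong) (simp_all add: spread_squeeze_image peaked_tile)
  then have "T = spread_tiling s ?T'"
    by (simp add: spread_tiling_def spread_squeeze_image peaked_boundary)
  then show ?thesis by blast
qed

end

definition ci_tilings :: "nat \<Rightarrow> tiling set" where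
  "ci_tilings n = {T. dyck_tiling n T \<and> cover_inclusive T}"

lemma ci_tilingsI: "ci_tiling n T hl hu \<Longrightarrow> T \<in> ci_tilings n"
  unfolding ci_tilings_def mem_Collect_eq ci_tiling_iff by blast

lemma ci_tilingsE:
  assumes "T \<in> ci_tilings n"
  obtains hl hu where "ci_tiling n T hl hu"
  using assms unfolding ci_tilings_def mem_Collect_eq ci_tiling_iff by blast

lemma spread_ci_tilings_iff:
  assumes "- int n \<le> s" "s \<le> int n"
  shows "spread_tiling s T \<in> ci_tilings (Suc n) \<longleftrightarrow> T \<in> ci_tilings n"
  unfolding ci_tilings_def by (simp add: dyck_tiling_spread[OF assms] cover_inclusive_spread)

lemma peak_tiling_spread:
  assumes "T \<in> ci_tilings n" and s: "- int n \<le> s" "s \<le> int n"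
  obtains hl hu where "peak_tiling (Suc n) (spread_tiling s T) hl hu s"
proof -
  obtain hl hu where ci: "ci_tiling (Suc n) (spread_tiling s T) hl hu"
    using assms(1) spread_ci_tilings_iff[OF s] ci_tilingsE by blast
  interpret ci_tiling "Suc n" "spread_tiling s T" hl hu by (fact ci)
  have pk: "peaked s (upper (spread_tiling s T))" by (simp add: spread_tiling_def peaked_spread)
  have "(s, hu s - 1 + 1) \<in> upper (spread_tiling s T)"
    unfolding upper mem_graph_on using s by simp
  then have "(s - 1, hu s - 1) \<in> upper (spread_tiling s T)" "(s + 1, hu s - 1) \<in> upper (spread_tiling s T)"
    using peakedD[OF pk] by blast+
  then have "hu s = hu (s - 1) + 1" "hu (s + 1) = hu s - 1"
    unfolding upper mem_graph_on by auto
  moreover have "{(s, hu s - 2)} \<notin> tiles (spread_tiling s T)"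
  proof
    assume "{(s, hu s - 2)} \<in> tiles (spread_tiling s T)"
    then obtain t where t: "{(s, hu s - 2)} = spread s t" by (auto simp: spread_tiling_def)
    then have "(s - 1, hu s - 3) \<in> spread s t"
      using peakedD(1)[OF peaked_spread, of s "hu s - 3" t] by auto
    then show False unfolding t[symmetric] by simp
  qed
  ultimately have "peak_tiling (Suc n) (spread_tiling s T) hl hu s"
    by unfold_locales (use s in auto)
  then show ?thesis using that by blast
qed

text \<open>Both growth maps spread and then add the boxes \<open>new s T\<close>. The inverse locates the growth site
  as the special column and recovers the added boxes as \<open>old s T\<close>.\<close>

locale growth =
  fixes grow :: "tiling \<Rightarrow> int \<Rightarrow> tiling" and new old :: "int \<Rightarrow> tiling \<Rightarrow> point set"
  assumes grow_eq: "grow T s = add_boxes (new s (spread_tiling s T)) (spread_tiling s T)"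
    and add_new: "peak_tiling m T hl hu s \<Longrightarrow>
      add_boxes (new s T) T \<in> ci_tilings m \<and> special_column (add_boxes (new s T) T) = s \<and>
      old s (add_boxes (new s T) T) = new s T \<and> remove_boxes (new s T) (add_boxes (new s T) T) = T"
    and remove_old: "m > 0 \<Longrightarrow> ci_tiling m T hl hu \<Longrightarrow> s = special_column T \<Longrightarrow>
      (\<exists>k. peak_tiling m (remove_boxes (old s T) T) hl k s) \<and>
      new s (remove_boxes (old s T) T) = old s T \<and> add_boxes (old s T) (remove_boxes (old s T) T) = T"
begin

lemma grow_ci_tilings:
  assumes "T \<in> ci_tilings n" "- int n \<le> s" "s \<le> int n"
  shows "grow T s \<in> ci_tilings (Suc n)" "lower (grow T s) = spread s (lower T)"
    "special_column (grow T s) = s"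
    "remove_boxes (old s (grow T s)) (grow T s) = spread_tiling s T"
proof -
  obtain hl hu where "peak_tiling (Suc n) (spread_tiling s T) hl hu s"
    using peak_tiling_spread[OF assms] .
  from add_new[OF this] show "grow T s \<in> ci_tilings (Suc n)" "special_column (grow T s) = s"
    "remove_boxes (old s (grow T s)) (grow T s) = spread_tiling s T"
    unfolding grow_eq by simp_all
  show "lower (grow T s) = spread s (lower T)"
    unfolding grow_eq by (simp add: add_boxes_def spread_tiling_def)
qed

lemma grow_inject:
  assumes "T \<in> ci_tilings n" "- int n \<le> s" "s \<le> int n"
    and "T' \<in> ci_tilings n" "- int n \<le> s'" "s' \<le> int n"
    and eq: "grow T s = grow T' s'"
  shows "T = T' \<and> s = s'"
proof -
  have s: "s = s'" using grow_ci_tilings(3)[OF assms(1-3)] grow_ci_tilings(3)[OF assms(4-6)] eq by simp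
  then have "spread_tiling s T = spread_tiling s T'"
    using grow_ci_tilings(4)[OF assms(1-3)] grow_ci_tilings(4)[OF assms(4-6)] eq by simp
  then show ?thesis using s inj_spread_tiling by (auto dest: injD)
qed

lemma grow_surj:
  assumes "U \<in> ci_tilings (Suc n)"
  obtains T s where "T \<in> ci_tilings n" "- int n \<le> s" "s \<le> int n" "U = grow T s"
proof -
  obtain hl hu where U: "ci_tiling (Suc n) U hl hu" using assms ci_tilingsE by blast
  define s where "s = special_column U"
  define W where "W = remove_boxes (old s U) U"
  obtain k where pk: "peak_tiling (Suc n) W hl k s"
    and new: "new s W = old s U" and add: "add_boxes (old s U) W = U"
    using remove_old[OF _ U s_def] unfolding W_def by auto
  interpret peak_tiling "Suc n" W hl k s by (fact pk)
  obtain T where T: "W = spread_tiling s T" using ex_spread by blast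
  have s: "- int n \<le> s" "s \<le> int n" using s_bounds by auto
  have "W \<in> ci_tilings (Suc n)" by (rule ci_tilingsI) (rule ci_tiling_axioms)
  then have "T \<in> ci_tilings n" unfolding T spread_ci_tilings_iff[OF s] .
  moreover have "U = grow T s" unfolding grow_eq using T new add by simp
  ultimately show ?thesis using that s by blast
qed

end

section \<open>Strip-grow and ribbon-grow\<close>

definition strip_new :: "int \<Rightarrow> tiling \<Rightarrow> point set" where
  "strip_new s T = {(x, y) \<in> upper T. s \<le> x \<and> (x + 1, y + 1) \<in> upper T}"

text \<open>The upper left edge of the box \<open>(x, y)\<close> runs from
  \<open>(x - 1, y + 1)\<close> to \<open>(x, y + 2)\<close>, so these are the boxes directly below
  the up steps that end right of \<open>s\<close>.\<close>

definition strip_old :: "int \<Rightarrow> tiling \<Rightarrow> point set" where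
  "strip_old s T = {(x, y). s < x \<and> (x - 1, y + 1) \<in> upper T \<and> (x, y + 2) \<in> upper T}"

text \<open>The boxes move the upper path from column \<open>s + 1\<close> on by (-1, +1):
  \<open>k x = hu (x + 1) + 1\<close> for \<open>s \<le> x\<close> and \<open>x < int m\<close>, and
  a down step follows. The fact \<open>k_shift\<close> states this for the steps.\<close>

lemma (in peak_tiling) strip_add:
  defines "U \<equiv> add_boxes (strip_new s T) T"
  shows "U \<in> ci_tilings m" "special_column U = s" "strip_old s U = strip_new s T"
    "remove_boxes (strip_new s T) U = T"
proof -
  define k where "k x = (if s \<le> x \<and> x < int m \<and> hu (x + 1) = hu x + 1 then hu x + 2 else hu x)" for x
  have k_cases: "k x = hu x \<or> k x = hu x + 2" for x by (simp add: k_def)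
  have k_left: "k x = hu x" if "x \<le> s" for x
    using that down_step by (cases "x = s") (simp_all add: k_def)
  have k_shift: "k (x + 1) - k x = (if x + 1 < int m then hu (x + 2) - hu (x + 1) else - 1)" if "s \<le> x" "x < int m" for x
  proof -
    have "hu (x + 1) = hu x + 1 \<or> hu (x + 1) = hu x - 1" using hu_step[of x] s_bounds that by simp
    moreover have "hu (x + 2) = hu (x + 1) + 1 \<or> hu (x + 2) = hu (x + 1) - 1" if "x + 1 < int m"
      using hu_step[of "x + 1"] s_bounds that \<open>s \<le> x\<close> by (simp add: add.assoc)
    moreover have "hu (x + 1) = hu x - 1" if "x + 1 = int m"
      using that calculation(1) hu_right hu_nonneg[of x] s_bounds \<open>s \<le> x\<close> by auto
    ultimately show ?thesis using that by (auto simp: k_def add.assoc)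
  qed
  have arc: "dyck_arc (- int m) (int m) k"
  proof (rule dyck_arcI)
    fix x assume x: "- int m \<le> x" "x < int m"
    consider "x < s" | "s \<le> x" "x + 1 < int m" | "s \<le> x" "x + 1 = int m" using x by linarith
    then show "k (x + 1) = k x + 1 \<or> k (x + 1) = k x - 1"
    proof cases
      case 1
      then show ?thesis using k_left hu_step[of x] x by simp
    next
      case 2
      then show ?thesis using k_shift[of x] hu_step[of "x + 1"] x by (auto simp: add.assoc)
    next
      case 3
      then show ?thesis using k_shift[of x] by auto
    qed
  next
    fix x assume x: "- int m \<le> x" "x \<le> int m"
    show "k (- int m) \<le> k x"
      using k_left[of "- int m"] hu_left s_bounds hu_nonneg[OF x] k_cases[of x] by auto
  next
    show "k (- int m) = k (int m)"
      using k_left[of "- int m"] hu_left hu_right s_bounds by (simp add: k_def)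
  qed (use s_bounds in simp)
  have new: "(x, y) \<in> strip_new s T \<longleftrightarrow> - int m \<le> x \<and> x \<le> int m \<and> y = hu x \<and> k x = hu x + 2" for x y
    unfolding strip_new_def upper using s_bounds by (auto simp: mem_graph_on k_def)
  have k0: "k (- int m) = 0" using k_left[of "- int m"] hu_left s_bounds by simp
  note add = ci_tiling_add_boxes[OF arc k_cases new k0, folded U_def]
  show "remove_boxes (strip_new s T) U = T" by (fact add(2))
  show "U \<in> ci_tilings m" by (rule ci_tilingsI[OF add(1)])
  interpret U: ci_tiling m U hl k by (fact add(1))
  have tl: "tiles U = tiles T \<union> {{b} | b. b \<in> strip_new s T}" by (simp add: U_def add_boxes_def)
  \<comment> \<open>An up step of the new path that ends right of \<open>s\<close> always ends on
    top of a new box. This rules out eligible columns right of \<open>s\<close> and identifies the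
    added boxes.\<close>
  have raised: "k x = hu x + 2" if "s < x" "x \<le> int m" "k x = k (x - 1) + 1" for x
  proof (rule ccontr)
    assume "k x \<noteq> hu x + 2"
    then have "k x = hu x" using k_cases[of x] by simp
    moreover have "hu x = hu (x - 1) + 1 \<or> hu x = hu (x - 1) - 1" using hu_step'[of x] that s_bounds by simp
    ultimately show False using that by (auto simp: k_def split: if_splits)
  qed
  show "special_column U = s"
  proof (rule U.special_column_eq)
    have "(s, hu s - 2) \<notin> strip_new s T" unfolding new by simp
    then have "{(s, hu s - 2)} \<notin> tiles U" using no_top_box unfolding tl by auto
    then show "eligible U s"
      unfolding U.eligible_iff using k_left[of s] k_left[of "s - 1"] s_bounds up_step by simp
    fix x assume x: "s < x"
    show "\<not> eligible U x"
    proof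
      assume "eligible U x"
      then have el: "x \<le> int m" "k x = k (x - 1) + 1" "{(x, k x - 2)} \<notin> tiles U"
        unfolding U.eligible_iff by blast+
      have "k x = hu x + 2" using raised x el by blast
      then have "(x, k x - 2) \<in> strip_new s T" unfolding new using el x s_bounds by simp
      then show False using el(3) unfolding tl by blast
    qed
  qed
  show "strip_old s U = strip_new s T"
  proof (rule point_set_eqI)
    fix x y
    have raised': "s < x \<and> k (x - 1) = hu x + 1" if "k x = hu x + 2" "- int m \<le> x" "x \<le> int m"
    proof -
      have x: "s < x" using that(1) k_left[of x] by (cases "x \<le> s") auto
      then show ?thesis
        using hu_step'[of x] that s_bounds by (auto simp: k_def)
    qed
    have "(x, y) \<in> strip_old s U \<longleftrightarrow> s < x \<and> x \<le> int m \<and> y + 1 = k (x - 1) \<and> y + 2 = k x"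
      unfolding strip_old_def U.upper using s_bounds by (auto simp: mem_graph_on)
    also have "\<dots> \<longleftrightarrow> - int m \<le> x \<and> x \<le> int m \<and> y = hu x \<and> k x = hu x + 2"
    proof
      assume *: "s < x \<and> x \<le> int m \<and> y + 1 = k (x - 1) \<and> y + 2 = k x"
      then have "k x = hu x + 2" by (intro raised) simp_all
      with * show "- int m \<le> x \<and> x \<le> int m \<and> y = hu x \<and> k x = hu x + 2" using s_bounds by simp
    next
      assume *: "- int m \<le> x \<and> x \<le> int m \<and> y = hu x \<and> k x = hu x + 2"
      then show "s < x \<and> x \<le> int m \<and> y + 1 = k (x - 1) \<and> y + 2 = k x" using raised' by simp
    qed
    finally show "(x, y) \<in> strip_old s U \<longleftrightarrow> (x, y) \<in> strip_new s T" unfolding new .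
  qed
qed

text \<open>As \<open>s\<close> is special, each up step ending right of \<open>s\<close> ends on a
  one-box tile. Removing all of these moves the path by (+1, -1):
  \<open>k x = hu (x - 1) - 1\<close> for \<open>s < x\<close> and \<open>x \<le> int m\<close>,
  which leaves a peak at \<open>s\<close>.\<close>

lemma (in ci_tiling) strip_remove:
  assumes "m > 0"
  defines "s \<equiv> special_column T"
  defines "W \<equiv> remove_boxes (strip_old s T) T"
  shows "\<exists>k. peak_tiling m W hl k s" "strip_new s W = strip_old s T" "add_boxes (strip_old s T) W = T"
proof -
  note s = special_column_properties[OF assms(1), folded s_def]
  define k where "k x = (if s < x \<and> x \<le> int m \<and> hu x = hu (x - 1) + 1 then hu x - 2 else hu x)" for x
  have k_cases: "k x = hu x \<or> k x = hu x - 2 \<and> {(x, hu x - 2)} \<in> tiles T" for x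
    using s(5) by (simp add: k_def)
  have k_left: "k x = hu x" if "x \<le> s" for x
    using that by (simp add: k_def)
  have k_right: "k (int m) = hu (int m)"
    using hu_right hu_nonneg[of "int m - 1"] assms(1) by (auto simp: k_def)
  have k_shift: "k (x + 1) - k x = (if s < x then hu x - hu (x - 1) else - 1)" if "s \<le> x" "x < int m" for x
    using hu_step[of x] hu_step'[of x] s(1) that by (auto simp: k_def)
  have arc: "dyck_arc (- int m) (int m) k"
  proof (rule dyck_arcI)
    fix x assume x: "- int m \<le> x" "x < int m"
    consider "x < s" | "x = s" | "s < x" using x by linarith
    then show "k (x + 1) = k x + 1 \<or> k (x + 1) = k x - 1"
    proof cases
      case 1
      then show ?thesis using k_left hu_step[of x] x by simp
    next
      case 2
      then show ?thesis using k_shift[of x] x by auto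
    next
      case 3
      then show ?thesis using k_shift[of x] hu_step'[of x] x s(1) by auto
    qed
  next
    fix x assume x: "- int m \<le> x" "x \<le> int m"
    show "k (- int m) \<le> k x"
      using k_left[of "- int m"] hu_left s(1) hu_nonneg[OF x] hl_nonneg[OF x] k_cases[of x] top_box_le(3)[of x]
      by auto
  next
    show "k (- int m) = k (int m)"
      using k_left[of "- int m"] hu_left hu_right s(1) k_right by simp
  qed simp
  have old: "(x, y) \<in> strip_old s T \<longleftrightarrow> - int m \<le> x \<and> x \<le> int m \<and> y = k x \<and> k x = hu x - 2" for x y
    unfolding strip_old_def upper using s(1) by (auto simp: mem_graph_on k_def)
  note rem = ci_tiling_remove_boxes[OF arc k_cases old, folded W_def]
  show "add_boxes (strip_old s T) W = T" by (fact rem(2))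
  interpret W: ci_tiling m W hl k by (fact rem(1))
  have tl: "tiles W \<subseteq> tiles T" by (auto simp: W_def remove_boxes_def)
  have "peak_tiling m W hl k s"
  proof
    show "k (s + 1) = k s - 1" using k_shift[of s] s(2) by simp
    show "k s = k (s - 1) + 1" using k_left s(3) by simp
    show "{(s, k s - 2)} \<notin> tiles W" using tl s(4) k_left[of s] by auto
  qed (fact s)+
  then show "\<exists>k. peak_tiling m W hl k s" by blast
  show "strip_new s W = strip_old s T"
  proof (rule point_set_eqI)
    fix x y
    \<comment> \<open>For \<open>x > s\<close> the step leaving column \<open>x\<close> copies the
      step of \<open>hu\<close> into \<open>x\<close>, which goes up exactly if the box in column
      \<open>x\<close> was removed. For \<open>x = s\<close> both sides are false.\<close>
    have "k (x + 1) = k x + 1 \<longleftrightarrow> k x = hu x - 2" if "s \<le> x" "x < int m"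
      using k_shift[OF that] that s(1) hu_step'[of x] by (auto simp: k_def)
    moreover have "s \<le> x \<and> x < int m" if "k x = hu x - 2"
    proof -
      have "s < x" using that k_left[of x] by (cases "x \<le> s") auto
      moreover have "x < int m" using that k_right by (cases "x = int m") (auto simp: k_def split: if_splits)
      ultimately show ?thesis by simp
    qed
    ultimately show "(x, y) \<in> strip_new s W \<longleftrightarrow> (x, y) \<in> strip_old s T"
      unfolding old strip_new_def W.upper mem_Collect_eq prod.case mem_graph_on
      using s(1) by auto
  qed
qed

global_interpretation strip: growth strip_grow strip_new strip_old
proof
  show "strip_grow T s = add_boxes (strip_new s (spread_tiling s T)) (spread_tiling s T)" for T s
    unfolding strip_grow_def strip_new_def Let_def ..
  show "add_boxes (strip_new s T) T \<in> ci_tilings m \<and> special_column (add_boxes (strip_new s T) T) = s \<and>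
      strip_old s (add_boxes (strip_new s T) T) = strip_new s T \<and>
      remove_boxes (strip_new s T) (add_boxes (strip_new s T) T) = T"
    if "peak_tiling m T hl hu s" for m T hl hu s
    using peak_tiling.strip_add[OF that] by blast
  show "(\<exists>k. peak_tiling m (remove_boxes (strip_old s T) T) hl k s) \<and>
      strip_new s (remove_boxes (strip_old s T) T) = strip_old s T \<and>
      add_boxes (strip_old s T) (remove_boxes (strip_old s T) T) = T"
    if "m > 0" "ci_tiling m T hl hu" "s = special_column T" for m T hl hu s
    using ci_tiling.strip_remove[OF that(2,1)] that(3) by blast
qed

section \<open>Ribbon-grow and its inverse\<close>

definition ribbon_new :: "int \<Rightarrow> tiling \<Rightarrow> point set" where
  "ribbon_new s T = {(x, y) \<in> upper T. s < x \<and> x < special_column T}"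

definition ribbon_old :: "int \<Rightarrow> tiling \<Rightarrow> point set" where
  "ribbon_old s T = {(x, y). s < x \<and> (x, y + 2) \<in> upper T \<and>
    (\<forall>x'. s < x' \<longrightarrow> x' \<le> x \<longrightarrow> (\<exists>y'. (x', y' + 2) \<in> upper T \<and> {(x', y')} \<in> tiles T))}"

lemma (in ci_tiling) mem_ribbon_old:
  assumes "- int m \<le> s"
  shows "(x, y) \<in> ribbon_old s T \<longleftrightarrow> s < x \<and> y = hu x - 2 \<and>
    (\<forall>x'. s < x' \<longrightarrow> x' \<le> x \<longrightarrow> {(x', hu x' - 2)} \<in> tiles T)"
proof -
  have top: "(\<exists>y'. (x', y' + 2) \<in> upper T \<and> {(x', y')} \<in> tiles T) \<longleftrightarrow> {(x', hu x' - 2)} \<in> tiles T" for x'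
  proof
    assume "\<exists>y'. (x', y' + 2) \<in> upper T \<and> {(x', y')} \<in> tiles T"
    then obtain y' where y': "hu x' = y' + 2" "{(x', y')} \<in> tiles T" unfolding upper mem_graph_on by metis
    show "{(x', hu x' - 2)} \<in> tiles T" using y'(2) unfolding y'(1) by simp
  next
    assume "{(x', hu x' - 2)} \<in> tiles T"
    then have "(x', hu x' - 2 + 2) \<in> upper T \<and> {(x', hu x' - 2)} \<in> tiles T"
      unfolding upper mem_graph_on using top_box_le(1,2)[of x'] by auto
    then show "\<exists>y'. (x', y' + 2) \<in> upper T \<and> {(x', y')} \<in> tiles T" by blast
  qed
  show ?thesis
    unfolding ribbon_old_def mem_Collect_eq prod.case top
    unfolding upper mem_graph_on using top_box_le(1,2)[of x] by auto
qed

text \<open>If column \<open>s\<close> contains a box, its top box lies in a tile that also contains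
  the top box of column \<open>s + 1\<close>. So the run of one-box tiles right of \<open>s\<close>
  is empty before anything is added, which settles the case of an empty ribbon.\<close>

lemma (in peak_tiling) no_top_box_right: "{(s + 1, hu (s + 1) - 2)} \<notin> tiles T"
proof
  assume top: "{(s + 1, hu (s + 1) - 2)} \<in> tiles T"
  have "hl s \<noteq> hu s" using top_box_le(3)[OF top] lower_peak down_step by auto
  moreover have "even (hu s - hl s)" "hl s \<le> hu s" using parity_diff hl_le_hu s_bounds by auto
  ultimately have "hl s \<le> hu s - 2" "even (hu s - 2 - hl s)" by presburger+
  then obtain t where t: "t \<in> tiles T" "(s, hu s - 2) \<in> t"
    using ex_tile[of s "hu s - 2"] s_bounds by auto
  then have "(s + 1, hu (s + 1) - 2) \<in> t" using tile_top[OF t] down_step by simp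
  then have "t = {(s + 1, hu (s + 1) - 2)}" using tile_unique[OF _ _ t(1) top] by blast
  then show False using t(2) by simp
qed

text \<open>The old special column \<open>q\<close> is \<open>s\<close>, and nothing is added, or at
  least \<open>s + 2\<close>, as the step into \<open>s + 1\<close> goes down. In the second case
  the columns between \<open>s\<close> and \<open>q\<close> receive one-box tiles, the step into
  \<open>q\<close> becomes a down step, and the path beyond \<open>q\<close> is unchanged; so
  eligibility ends at \<open>s\<close>.\<close>

lemma (in peak_tiling) ribbon_add:
  defines "U \<equiv> add_boxes (ribbon_new s T) T"
  shows "U \<in> ci_tilings m" "special_column U = s" "ribbon_old s U = ribbon_new s T"
    "remove_boxes (ribbon_new s T) U = T"
proof -
  define q where "q = special_column T"
  have "m > 0" using s_bounds by auto
  note q = special_column_properties[OF this, folded q_def]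
  have "eligible T s" unfolding eligible_iff using s_bounds up_step no_top_box by simp
  then have "s \<le> q" unfolding q_def special_column_def using finite_eligible by simp
  have sq: "q = s \<or> s + 2 \<le> q"
  proof -
    have "q \<noteq> s + 1" using q(3) down_step by auto
    then show ?thesis using \<open>s \<le> q\<close> by linarith
  qed
  define k where "k x = (if s < x \<and> x < q then hu x + 2 else hu x)" for x
  have k_cases: "k x = hu x \<or> k x = hu x + 2" for x by (simp add: k_def)
  have k0: "k (- int m) = 0" using hu_left s_bounds by (simp add: k_def)
  have arc: "dyck_arc (- int m) (int m) k"
  proof (rule dyck_arcI)
    fix x assume x: "- int m \<le> x" "x < int m"
    consider "q = s \<or> x < s \<or> q \<le> x" | "x = s" "s + 2 \<le> q" | "s < x" "x + 1 < q" | "s < x" "x + 1 = q"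
      using sq by linarith
    then show "k (x + 1) = k x + 1 \<or> k (x + 1) = k x - 1"
    proof cases
      case 1
      then have "k (x + 1) = hu (x + 1)" "k x = hu x" by (auto simp: k_def)
      then show ?thesis using hu_step[OF x] by simp
    next
      case 2
      then show ?thesis using down_step by (simp add: k_def)
    next
      case 3
      then show ?thesis using hu_step[OF x] by (auto simp: k_def)
    next
      case 4
      then have "q = x + 1" by simp
      then have "hu (x + 1) = hu x + 1" using q(3) by simp
      moreover have "k (x + 1) = hu (x + 1)" "k x = hu x + 2" using 4 by (auto simp: k_def)
      ultimately show ?thesis by simp
    qed
  next
    fix x assume x: "- int m \<le> x" "x \<le> int m"
    show "k (- int m) \<le> k x" using k0 hu_nonneg[OF x] k_cases[of x] by auto
  next
    show "k (- int m) = k (int m)" using k0 hu_right q(2) by (simp add: k_def)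
  qed simp
  have new: "(x, y) \<in> ribbon_new s T \<longleftrightarrow> - int m \<le> x \<and> x \<le> int m \<and> y = hu x \<and> k x = hu x + 2" for x y
    unfolding ribbon_new_def upper q_def[symmetric] by (auto simp: mem_graph_on k_def)
  have new': "(x, y) \<in> ribbon_new s T \<longleftrightarrow> s < x \<and> x < q \<and> y = hu x" for x y
    unfolding ribbon_new_def upper q_def[symmetric] using s_bounds q(2) by (auto simp: mem_graph_on)
  note add = ci_tiling_add_boxes[OF arc k_cases new k0, folded U_def]
  show "remove_boxes (ribbon_new s T) U = T" by (fact add(2))
  show "U \<in> ci_tilings m" by (rule ci_tilingsI[OF add(1)])
  interpret U: ci_tiling m U hl k by (fact add(1))
  have tl: "{p} \<in> tiles U \<longleftrightarrow> {p} \<in> tiles T \<or> p \<in> ribbon_new s T" for p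
  proof -
    have "tiles U = tiles T \<union> {{b} | b. b \<in> ribbon_new s T}" by (simp add: U_def add_boxes_def)
    then show ?thesis by blast
  qed
  have top: "{(x, k x - 2)} \<in> tiles U" if "s < x" "x < q" for x
    using that unfolding tl new' by (simp add: k_def)
  show "special_column U = s"
  proof (rule U.special_column_eq)
    show "eligible U s"
      unfolding U.eligible_iff tl new' using no_top_box s_bounds up_step by (simp add: k_def)
    fix x assume x: "s < x"
    show "\<not> eligible U x"
    proof
      assume "eligible U x"
      then have el: "x \<le> int m" "k x = k (x - 1) + 1" "{(x, k x - 2)} \<notin> tiles U"
        unfolding U.eligible_iff by blast+
      consider "x < q" | "x = q" | "q < x" by linarith
      then show False
      proof cases
        case 1
        then show ?thesis using top x el(3) by blast
      next
        case 2
        then show ?thesis using el(2) q(3) sq x by (simp add: k_def)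
      next
        case 3
        then have "k x = hu x" "k (x - 1) = hu (x - 1)" by (simp_all add: k_def)
        then show ?thesis using q(5)[OF 3 el(1)] el(2,3) unfolding tl by simp
      qed
    qed
  qed
  show "ribbon_old s U = ribbon_new s T"
  proof (rule point_set_eqI)
    fix x y
    \<comment> \<open>The run of one-box tiles stops at \<open>s + 1\<close> if nothing was added,
      and otherwise at \<open>q\<close>, which had no such tile on top and is not raised.\<close>
    have "\<exists>x'. s < x' \<and> x' \<le> x \<and> {(x', k x' - 2)} \<notin> tiles U" if "s < x" "q \<le> x"
    proof (cases "q = s")
      case True
      then have "{(s + 1, k (s + 1) - 2)} \<notin> tiles U"
        unfolding tl new' using no_top_box_right by (simp add: k_def)
      then show ?thesis using that by (intro exI[of _ "s + 1"]) simp
    next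
      case False
      have "{(q, k q - 2)} \<notin> tiles U" unfolding tl new' using q(4) by (simp add: k_def)
      then show ?thesis using that False \<open>s \<le> q\<close> by (intro exI[of _ q]) auto
    qed
    then have "(\<forall>x'. s < x' \<longrightarrow> x' \<le> x \<longrightarrow> {(x', k x' - 2)} \<in> tiles U) \<longleftrightarrow> x < q" if "s < x"
      using top that by (meson le_less_trans not_le)
    moreover have "k x - 2 = hu x" if "s < x" "x < q" using that by (simp add: k_def)
    ultimately show "(x, y) \<in> ribbon_old s U \<longleftrightarrow> (x, y) \<in> ribbon_new s T"
      using s_bounds U.mem_ribbon_old[of s x y] unfolding new' by auto
  qed
qed

text \<open>Let \<open>r\<close> be the first column right of \<open>s\<close> without a one-box
  tile on top. Since \<open>s\<close> is special, the step into \<open>r\<close> goes down; lowering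
  the columns in between turns it into an up step, and the ribbon can be restored by growing up to
  \<open>r\<close>.\<close>

lemma (in ci_tiling) ribbon_remove:
  assumes "m > 0"
  defines "s \<equiv> special_column T"
  defines "W \<equiv> remove_boxes (ribbon_old s T) T"
  shows "\<exists>k. peak_tiling m W hl k s" "ribbon_new s W = ribbon_old s T" "add_boxes (ribbon_old s T) W = T"
proof -
  note s = special_column_properties[OF assms(1), folded s_def]
  obtain r where r: "s < r" "r \<le> int m" "{(r, hu r - 2)} \<notin> tiles T"
    and top: "\<And>x. s < x \<Longrightarrow> x < r \<Longrightarrow> {(x, hu x - 2)} \<in> tiles T"
  proof -
    define P where "P j \<longleftrightarrow> {(s + 1 + int j, hu (s + 1 + int j) - 2)} \<notin> tiles T" for j
    \<comment> \<open>Column \<open>int m\<close> contains no box, so the search for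
      \<open>r\<close> ends there at the latest.\<close>
    have "P (nat (int m - s - 1))" unfolding P_def using s(2) top_box_le(2)[of "int m"] by auto
    then have P: "P (LEAST j. P j)" and le: "(LEAST j. P j) \<le> nat (int m - s - 1)"
      by (rule LeastI, rule Least_le)
    define r where "r = s + 1 + int (LEAST j. P j)"
    have "s < r" "r \<le> int m" using le s(2) by (auto simp: r_def)
    moreover have "{(r, hu r - 2)} \<notin> tiles T" using P unfolding P_def r_def .
    moreover have "{(x, hu x - 2)} \<in> tiles T" if "s < x" "x < r" for x
    proof -
      have "nat (x - s - 1) < (LEAST j. P j)" using that by (simp add: r_def)
      then have "\<not> P (nat (x - s - 1))" by (rule not_less_Least)
      then show ?thesis using that by (simp add: P_def)
    qed
    ultimately show ?thesis using that by blast
  qed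
  \<comment> \<open>If a down step follows \<open>s\<close>, the tiling already meets the conditions
    of \<open>peak_tiling\<close> and the run is empty. If an up step follows, column
    \<open>s + 1\<close> carries a one-box tile because \<open>s\<close> is special.\<close>
  have down_s: "hu (s + 1) = hu s - 1 \<longleftrightarrow> r = s + 1"
  proof
    assume d: "hu (s + 1) = hu s - 1"
    interpret peak_tiling m T hl hu s by unfold_locales (use s d in auto)
    show "r = s + 1" using no_top_box_right top[of "s + 1"] r(1) by (cases "r = s + 1") auto
  next
    assume "r = s + 1"
    then show "hu (s + 1) = hu s - 1" using s(5)[of "s + 1"] r hu_step[of s] s(1,2) by auto
  qed
  have down_r: "hu r = hu (r - 1) - 1" using s(5)[of r] r hu_step'[of r] s(1) by auto
  define k where "k x = (if s < x \<and> x < r then hu x - 2 else hu x)" for x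
  have k_cases: "k x = hu x \<or> k x = hu x - 2 \<and> {(x, hu x - 2)} \<in> tiles T" for x
    using top by (simp add: k_def)
  have arc: "dyck_arc (- int m) (int m) k"
  proof (rule dyck_arcI)
    fix x assume x: "- int m \<le> x" "x < int m"
    consider "r = s + 1 \<or> x < s \<or> r \<le> x" | "x = s" "s + 1 < r" | "s < x" "x + 1 < r" | "s < x" "x + 1 = r"
      using r by linarith
    then show "k (x + 1) = k x + 1 \<or> k (x + 1) = k x - 1"
    proof cases
      case 1
      then have "k (x + 1) = hu (x + 1)" "k x = hu x" by (auto simp: k_def)
      then show ?thesis using hu_step[OF x] by simp
    next
      case 2
      then show ?thesis using down_s hu_step[OF x] by (simp add: k_def)
    next
      case 3
      then show ?thesis using hu_step[OF x] by (auto simp: k_def)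
    next
      case 4
      then have "r = x + 1" by simp
      then have "hu (x + 1) = hu x - 1" using down_r by simp
      moreover have "k (x + 1) = hu (x + 1)" "k x = hu x - 2" using 4 by (auto simp: k_def)
      ultimately show ?thesis by simp
    qed
  next
    fix x assume x: "- int m \<le> x" "x \<le> int m"
    show "k (- int m) \<le> k x"
      using hu_left s(1) hu_nonneg[OF x] hl_nonneg[OF x] k_cases[of x] top_box_le(3)[of x]
      by (auto simp: k_def)
  next
    show "k (- int m) = k (int m)" using hu_left hu_right s(1) r(2) by (simp add: k_def)
  qed simp
  have old': "(x, y) \<in> ribbon_old s T \<longleftrightarrow> s < x \<and> x < r \<and> y = hu x - 2" for x y
  proof -
    have "(\<forall>x'. s < x' \<longrightarrow> x' \<le> x \<longrightarrow> {(x', hu x' - 2)} \<in> tiles T) \<longleftrightarrow> x < r"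
      using top r(1,3) by (meson le_less_trans not_le)
    then show ?thesis using mem_ribbon_old[of s x y] s(1) by auto
  qed
  have old: "(x, y) \<in> ribbon_old s T \<longleftrightarrow> - int m \<le> x \<and> x \<le> int m \<and> y = k x \<and> k x = hu x - 2" for x y
    unfolding old' using s(1) r(2) by (auto simp: k_def)
  note rem = ci_tiling_remove_boxes[OF arc k_cases old, folded W_def]
  show "add_boxes (ribbon_old s T) W = T" by (fact rem(2))
  interpret W: ci_tiling m W hl k by (fact rem(1))
  have tl: "{p} \<in> tiles W \<longleftrightarrow> {p} \<in> tiles T \<and> p \<notin> ribbon_old s T" for p
    unfolding W_def remove_boxes_def by (cases p) auto
  have "peak_tiling m W hl k s"
  proof
    show "k (s + 1) = k s - 1" using down_s hu_step[of s] s(1,2) r(1) by (auto simp: k_def)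
    show "k s = k (s - 1) + 1" using s(3) by (simp add: k_def)
    show "{(s, k s - 2)} \<notin> tiles W" unfolding tl using s(4) by (simp add: k_def)
  qed (fact s)+
  then show "\<exists>k. peak_tiling m W hl k s" by blast
  have right: "\<not> eligible W x" if "r \<le> x" "x \<noteq> r \<or> r = s + 1" for x
  proof
    assume "eligible W x"
    then have el: "x \<le> int m" "k x = k (x - 1) + 1" "{(x, k x - 2)} \<notin> tiles W"
      unfolding W.eligible_iff by blast+
    have "k x = hu x" "k (x - 1) = hu (x - 1)" using that by (auto simp: k_def)
    then show False using el s(5)[of x] that r(1) unfolding tl old' by auto
  qed
  \<comment> \<open>Beyond \<open>r\<close> nothing changed, so no column there is eligible. After a
    nonempty removal \<open>r\<close> ends an up step without a one-box tile and becomes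
    special.\<close>
  have "special_column W = (if r = s + 1 then s else r)"
  proof (cases "r = s + 1")
    case True
    have "special_column W = s"
    proof (rule W.special_column_eq)
      show "eligible W s"
        unfolding W.eligible_iff tl using s by (simp add: k_def)
    qed (use right True in auto)
    with True show ?thesis by simp
  next
    case False
    have "special_column W = r"
    proof (rule W.special_column_eq)
      show "eligible W r"
        unfolding W.eligible_iff tl using r s(1) False down_r by (simp add: k_def)
    qed (use right in auto)
    with False show ?thesis by simp
  qed
  then show "ribbon_new s W = ribbon_old s T"
    using s(1) r(1,2)
    by (intro point_set_eqI) (auto simp: ribbon_new_def old' W.upper mem_graph_on k_def)
qed

global_interpretation ribbon: growth ribbon_grow ribbon_new ribbon_old
proof
  show "ribbon_grow T s = add_boxes (ribbon_new s (spread_tiling s T)) (spread_tiling s T)" for T s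
  proof (cases "s < special_column (spread_tiling s T)")
    case False
    then have "ribbon_new s (spread_tiling s T) = {}" by (auto simp: ribbon_new_def)
    then show ?thesis using False by (simp add: ribbon_grow_def Let_def add_boxes_def)
  qed (simp add: ribbon_grow_def ribbon_new_def Let_def)
  show "add_boxes (ribbon_new s T) T \<in> ci_tilings m \<and> special_column (add_boxes (ribbon_new s T) T) = s \<and>
      ribbon_old s (add_boxes (ribbon_new s T) T) = ribbon_new s T \<and>
      remove_boxes (ribbon_new s T) (add_boxes (ribbon_new s T) T) = T"
    if "peak_tiling m T hl hu s" for m T hl hu s
    using peak_tiling.ribbon_add[OF that] by blast
  show "(\<exists>k. peak_tiling m (remove_boxes (ribbon_old s T) T) hl k s) \<and>
      ribbon_new s (remove_boxes (ribbon_old s T) T) = ribbon_old s T \<and>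
      add_boxes (ribbon_old s T) (remove_boxes (ribbon_old s T) T) = T"
    if "m > 0" "ci_tiling m T hl hu" "s = special_column T" for m T hl hu s
    using ci_tiling.ribbon_remove[OF that(2,1)] that(3) by blast
qed

section \<open>Chords under spreads\<close>

lemma mem_chords_graph_on:
  "(l, r) \<in> chords (graph_on a b h) \<longleftrightarrow> l \<le> r \<and> a < l \<and> r < b \<and>
    h (l - 1) = h l - 1 \<and> h r = h l \<and> h (r + 1) = h l - 1 \<and> (\<forall>x. l \<le> x \<longrightarrow> x \<le> r \<longrightarrow> h l \<le> h x)"
  unfolding chords_def mem_Collect_eq prod.case mem_graph_on by auto

text \<open>A span is an interval of columns and is replaced by its preimage under
  \<open>squeeze_col s\<close>. In particular a span that contains \<open>s\<close> comes to enclose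
  the new chord \<open>(s, s)\<close>.\<close>

definition chord_map :: "int \<Rightarrow> int \<times> int \<Rightarrow> int \<times> int" where
  "chord_map s c = (left_end s (fst c), right_end s (snd c))"

lemma left_end_mono: "left_end s a \<le> left_end s a' \<longleftrightarrow> a \<le> a'"
  and right_end_mono: "right_end s b \<le> right_end s b' \<longleftrightarrow> b \<le> b'"
  and right_end_less_left_end: "right_end s b < left_end s a \<longleftrightarrow> b < a"
  and left_end_less: "left_end s a < s \<longleftrightarrow> a \<le> s"
  and right_end_less: "right_end s b < s \<longleftrightarrow> b < s"
  and left_end_neq: "left_end s a \<noteq> s"
  by (auto simp: left_end_def right_end_def)

lemma inj_chord_map: "inj (chord_map s)"
proof (rule injI)
  fix c d :: "int \<times> int" assume "chord_map s c = chord_map s d"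
  then have "fst c = fst d" "snd c = snd d"
    using left_end_mono[of s "fst c" "fst d"] left_end_mono[of s "fst d" "fst c"]
      right_end_mono[of s "snd c" "snd d"] right_end_mono[of s "snd d" "snd c"]
    unfolding chord_map_def by simp_all
  then show "c = d" by (rule prod_eqI)
qed

text \<open>The spread inserts an adjacent up step and down step, matched with each other, and
  leaves the matching of the other steps intact.\<close>

lemma chords_spread_graph_on:
  assumes s: "a \<le> s" "s \<le> b"
  shows "chords (spread s (graph_on a b h)) = insert (s, s) (chord_map s ` chords (graph_on a b h))"
proof -
  let ?H = "lift_height s h" and ?P = "graph_on a b h"
  have S: "spread s ?P = graph_on (a - 1) (b + 1) ?H"
    using s by (simp add: spread_graph_on left_end_def right_end_def)
  have new: "(s, s) \<in> chords (spread s ?P)"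
    unfolding S mem_chords_graph_on using s by (auto simp: lift_height_simps)
  \<comment> \<open>Lower bounds over a span transfer both ways: apart from the raised column
    \<open>s\<close>, the lift takes the same heights, and the height \<open>h s\<close> also occurs
    in column \<open>s - 1\<close>.\<close>
  have range: "(\<forall>x. left_end s l \<le> x \<longrightarrow> x \<le> right_end s r \<longrightarrow> y \<le> ?H x) \<longleftrightarrow>
      (\<forall>x. l \<le> x \<longrightarrow> x \<le> r \<longrightarrow> y \<le> h x)" for l r y
  proof
    assume *: "\<forall>x. left_end s l \<le> x \<longrightarrow> x \<le> right_end s r \<longrightarrow> y \<le> ?H x"
    show "\<forall>x. l \<le> x \<longrightarrow> x \<le> r \<longrightarrow> y \<le> h x"
    proof (intro allI impI)
      fix x assume "l \<le> x" "x \<le> r"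
      moreover have "squeeze_col s (if x \<le> s then x - 1 else x + 1) = x" by (auto simp: squeeze_col_def)
      ultimately have "y \<le> ?H (if x \<le> s then x - 1 else x + 1)"
        using * unfolding left_end_le_iff le_right_end_iff by metis
      then show "y \<le> h x" unfolding lift_height_col .
    qed
  next
    assume *: "\<forall>x. l \<le> x \<longrightarrow> x \<le> r \<longrightarrow> y \<le> h x"
    show "\<forall>x. left_end s l \<le> x \<longrightarrow> x \<le> right_end s r \<longrightarrow> y \<le> ?H x"
    proof (intro allI impI)
      fix x assume "left_end s l \<le> x" "x \<le> right_end s r"
      then have "y \<le> h (squeeze_col s x)" using * unfolding left_end_le_iff le_right_end_iff by blast
      moreover have "h (squeeze_col s x) \<le> ?H x" by (simp add: lift_height_def squeeze_drop_def)
      ultimately show "y \<le> ?H x" by linarith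
    qed
  qed
  have old: "(left_end s l, right_end s r) \<in> chords (spread s ?P) \<longleftrightarrow> (l, r) \<in> chords ?P" for l r
  proof -
    have le: "left_end s l \<le> right_end s r \<longleftrightarrow> l \<le> r" using right_end_less_left_end[of s r l] by linarith
    have b: "a - 1 < left_end s l \<longleftrightarrow> a < l" "right_end s r < b + 1 \<longleftrightarrow> r < b"
      using s by (auto simp: left_end_def right_end_def)
    have H: "?H (left_end s l) = h l" "?H (left_end s l - 1) = h (l - 1)"
      "?H (right_end s r) = h r" "?H (right_end s r + 1) = h (r + 1)"
      by (auto simp: left_end_def right_end_def lift_height_simps add.commute[of 1])
    show ?thesis unfolding S mem_chords_graph_on H le b range ..
  qed
  \<comment> \<open>Any other chord has its left end outside \<open>s\<close>, \<open>s + 1\<close>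
    and its right end outside \<open>s - 1\<close>, \<open>s\<close>. These are exactly the columns
    that \<open>left_end s\<close> and \<open>right_end s\<close> miss.\<close>
  have img: "\<exists>l r. l' = left_end s l \<and> r' = right_end s r"
    if "(l', r') \<in> chords (spread s ?P)" "(l', r') \<noteq> (s, s)" for l' r'
  proof -
    have c: "l' \<le> r'" "?H (l' - 1) = ?H l' - 1" "?H r' = ?H l'" "?H (r' + 1) = ?H l' - 1"
      "\<And>x. l' \<le> x \<Longrightarrow> x \<le> r' \<Longrightarrow> ?H l' \<le> ?H x"
      using that(1) unfolding S mem_chords_graph_on by auto
    have peak: "?H (s - 1) = ?H s - 1" "?H (s + 1) = ?H s - 1" by (simp_all add: lift_height_simps)
    have "l' \<noteq> s"
    proof
      assume l: "l' = s"
      then have "s + 1 \<le> r'" using that(2) c(1) by auto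
      then show False using c(5)[of "s + 1"] l peak by simp
    qed
    moreover have "l' \<noteq> s + 1" using c(2) peak by auto
    moreover have "r' \<noteq> s"
    proof
      assume r: "r' = s"
      then have "l' \<le> s - 1" using \<open>l' \<noteq> s\<close> c(1) by auto
      then show False using c(5)[of "s - 1"] c(3) r peak by simp
    qed
    moreover have "r' \<noteq> s - 1" using c(3,4) peak by auto
    ultimately have "l' = left_end s (if l' < s then l' + 1 else l' - 1)"
      "r' = right_end s (if r' < s then r' + 1 else r' - 1)"
      by (auto simp: left_end_def right_end_def)
    then show ?thesis by blast
  qed
  show ?thesis
  proof (rule point_set_eqI)
    fix l' r'
    show "(l', r') \<in> chords (spread s ?P) \<longleftrightarrow> (l', r') \<in> insert (s, s) (chord_map s ` chords ?P)"
    proof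
      assume c: "(l', r') \<in> chords (spread s ?P)"
      show "(l', r') \<in> insert (s, s) (chord_map s ` chords ?P)"
      proof (cases "(l', r') = (s, s)")
        case False
        then obtain l r where lr: "l' = left_end s l" "r' = right_end s r" using img c by blast
        then have "(l, r) \<in> chords ?P" using c old by simp
        then have "chord_map s (l, r) \<in> chord_map s ` chords ?P" by (rule imageI)
        then show ?thesis by (simp add: chord_map_def lr)
      qed simp
    next
      assume "(l', r') \<in> insert (s, s) (chord_map s ` chords ?P)"
      then consider "(l', r') = (s, s)" | l r where "(l, r) \<in> chords ?P" "(l', r') = chord_map s (l, r)"
        by auto
      then show "(l', r') \<in> chords (spread s ?P)"
        using new old by cases (auto simp: chord_map_def)
    qed
  qed
qed

lemma chords_spread:
  assumes "dyck_path n P" "- int n \<le> s" "s \<le> int n"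
  shows "chords (spread s P) = insert (s, s) (chord_map s ` chords P)"
  using assms chords_spread_graph_on unfolding dyck_path_iff by blast

section \<open>Peaks and point chords\<close>

lemma ex_peak:
  fixes h :: "int \<Rightarrow> int"
  assumes arc: "dyck_arc a b h" and "l \<le> r" "a < l" "r < b" "h (l - 1) = h l - 1" "h (r + 1) = h r - 1"
  obtains x where "l \<le> x" "x \<le> r" "(x, x) \<in> chords (graph_on a b h)"
proof -
  \<comment> \<open>A column of maximal height is a peak; at the two ends of the interval the
    assumed steps replace the comparison with a neighbour.\<close>
  have "Max (h ` {l..r}) \<in> h ` {l..r}" using \<open>l \<le> r\<close> by (intro Max_in) auto
  then obtain x where x: "l \<le> x" "x \<le> r" "h x = Max (h ` {l..r})" by auto
  have max: "h z \<le> h x" if "l \<le> z" "z \<le> r" for z unfolding x(3) using that by simp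
  have "h (x - 1) = h x - 1"
  proof (cases "x = l")
    case False
    then show ?thesis using max[of "x - 1"] dyck_arcD(2)[OF arc, of "x - 1"] x(1,2) assms by auto
  qed (use assms in simp)
  moreover have "h (x + 1) = h x - 1"
  proof (cases "x = r")
    case False
    then show ?thesis using max[of "x + 1"] dyck_arcD(2)[OF arc, of x] x(1,2) assms by auto
  qed (use assms in simp)
  ultimately have "(x, x) \<in> chords (graph_on a b h)"
    unfolding mem_chords_graph_on using x assms by auto
  then show ?thesis using that x by blast
qed

lemma point_chord_spread:
  assumes P: "dyck_path (Suc n) P" and x: "(x, x) \<in> chords P"
  obtains P' where "- int n \<le> x" "x \<le> int n" "dyck_path n P'" "P = spread x P'"
proof -
  obtain h where h: "P = graph_on (- int (Suc n)) (int (Suc n)) h" using P unfolding dyck_path_iff by blast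
  have xb: "- int n \<le> x" "x \<le> int n" and hx: "h (x - 1) = h x - 1" "h (x + 1) = h x - 1"
    using x unfolding h mem_chords_graph_on by auto
  have "peaked x P" unfolding peaked_def h mem_graph_on using xb hx by auto
  then have eq: "P = spread x (squeeze x ` P)" by (simp add: spread_squeeze_image)
  then have "dyck_path n (squeeze x ` P)" using P dyck_path_spread[OF xb] by metis
  then show ?thesis using that xb eq by blast
qed

text \<open>The point chord lies in the given span, hence above the given chord in the poset. This
  forces the chord with the largest label to be a point.\<close>

lemma chord_above_point:
  assumes P: "dyck_path n P" and c: "(l, r) \<in> chords P"
  obtains x where "l \<le> x" "x \<le> r" "(x, x) \<in> chords P"
proof -
  obtain h where h: "dyck_arc (- int n) (int n) h" "P = graph_on (- int n) (int n) h"
    using P unfolding dyck_path_iff by blast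
  show ?thesis
    using c ex_peak[OF h(1), of l r] that unfolding h(2) mem_chords_graph_on by auto
qed

lemma dyck_path_Suc_spread:
  assumes P: "dyck_path (Suc n) P"
  obtains s P' where "- int n \<le> s" "s \<le> int n" "dyck_path n P'" "P = spread s P'"
proof -
  obtain h where h: "dyck_arc (- int (Suc n)) (int (Suc n)) h" "h (- int (Suc n)) = 0"
    "P = graph_on (- int (Suc n)) (int (Suc n)) h"
    using P unfolding dyck_path_iff by blast
  have "h (- int n) = 1"
    using dyck_arcD(2)[OF h(1), of "- int (Suc n)"] dyck_arcD(4)[OF h(1), of "- int n"] h(2) by auto
  moreover have "h (int n) = 1"
    using dyck_arcD(2)[OF h(1), of "int n"] dyck_arcD(4)[OF h(1), of "int n"] dyck_arcD(3)[OF h(1)] h(2)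
    by (auto simp: add.commute)
  moreover have m: "- int n - 1 = - int (Suc n)" "int n + 1 = int (Suc n)" by simp_all
  ultimately have steps: "h (- int n - 1) = h (- int n) - 1" "h (int n + 1) = h (int n) - 1"
    using dyck_arcD(3)[OF h(1)] h(2) unfolding m by simp_all
  \<comment> \<open>\<open>ex_peak\<close> is applied between the first up step and the last down
    step of the path.\<close>
  obtain x where "(x, x) \<in> chords P"
    unfolding h(3) by (rule ex_peak[OF h(1) _ _ _ steps]) auto
  then show ?thesis using point_chord_spread[OF P] that by metis
qed

lemma dyck_path_0: "dyck_path 0 P \<longleftrightarrow> P = {(0, 0)}"
proof
  assume "dyck_path 0 P"
  then show "P = {(0, 0)}" unfolding dyck_path_iff by (auto simp: graph_on_def)
next
  assume "P = {(0, 0)}"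
  then have "P = graph_on 0 0 (\<lambda>_. 0)" by (auto simp: graph_on_def)
  then show "dyck_path 0 P" unfolding dyck_path_iff
    by (intro exI[of _ "\<lambda>_. 0"]) (simp add: dyck_arc_def)
qed

lemma chords_origin: "chords {(0, 0)} = {}"
  by (auto simp: chords_def)

text \<open>Since each step up to column \<open>x\<close> is the up step or the down step of exactly one chord,
  the two cardinalities count these steps.\<close>

lemma chords_properties:
  assumes "dyck_path n P"
  shows "finite (chords P) \<and> card (chords P) = n \<and> inj_on fst (chords P) \<and>
    (\<forall>c\<in>chords P. fst c \<le> snd c) \<and>
    (\<forall>x. - int n \<le> x \<longrightarrow> x \<le> int n \<longrightarrow>
      int (card {c \<in> chords P. fst c \<le> x} + card {c \<in> chords P. snd c < x}) = x + int n)"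
  using assms
proof (induction n arbitrary: P)
  case 0
  then show ?case by (simp add: dyck_path_0 chords_origin)
next
  case (Suc n)
  obtain s P' where s: "- int n \<le> s" "s \<le> int n" and P': "dyck_path n P'" and P: "P = spread s P'"
    using dyck_path_Suc_spread[OF Suc.prems] .
  have IH: "finite (chords P')" "card (chords P') = n" "inj_on fst (chords P')"
    and le: "\<And>c. c \<in> chords P' \<Longrightarrow> fst c \<le> snd c"
    and count: "\<And>x. - int n \<le> x \<Longrightarrow> x \<le> int n \<Longrightarrow>
      int (card {c \<in> chords P'. fst c \<le> x} + card {c \<in> chords P'. snd c < x}) = x + int n"
    using Suc.IH[OF P'] by simp_all
  let ?C = "chords P'" and ?f = "chord_map s"
  have C: "chords P = insert (s, s) (?f ` ?C)" unfolding P by (rule chords_spread[OF P' s])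
  have notin: "(s, s) \<notin> ?f ` A" for A :: "(int \<times> int) set"
  proof
    assume "(s, s) \<in> ?f ` A"
    then obtain c where "(s, s) = ?f c" by blast
    then show False using left_end_neq[of s "fst c"] by (simp add: chord_map_def)
  qed
  note fin = IH(1)
  have card_f: "card (?f ` A) = card A" for A
    by (rule card_image) (rule inj_on_subset[OF inj_chord_map], simp)
  have "inj_on fst (chords P)"
  proof (rule inj_onI)
    fix c d assume cd: "c \<in> chords P" "d \<in> chords P" "fst c = fst d"
    show "c = d"
    proof (cases "c = (s, s) \<or> d = (s, s)")
      case True
      have "fst e \<noteq> s" if e: "e \<in> ?f ` ?C" for e
      proof -
        obtain d where "e = ?f d" using e by blast
        then show ?thesis using left_end_neq[of s "fst d"] by (simp add: chord_map_def)
      qed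
      moreover from True have "fst c = s" "fst d = s" using cd(3) by auto
      ultimately have "c \<notin> ?f ` ?C" "d \<notin> ?f ` ?C" by blast+
      then show ?thesis using cd(1,2) unfolding C by simp
    next
      case False
      then have "c \<in> ?f ` ?C" "d \<in> ?f ` ?C" using cd(1,2) unfolding C by simp_all
      then obtain c' d' where c'd': "c' \<in> ?C" "d' \<in> ?C" "c = ?f c'" "d = ?f d'" by blast
      have "left_end s (fst c') = left_end s (fst d')"
        using cd(3) unfolding c'd'(3,4) chord_map_def fst_conv .
      then have eq: "fst c' = fst d'"
        using left_end_mono[of s "fst c'" "fst d'"] left_end_mono[of s "fst d'" "fst c'"] by simp
      have "c' = d'" by (rule inj_onD[OF IH(3) eq c'd'(1,2)])
      then show ?thesis unfolding c'd'(3,4) by (rule arg_cong)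
    qed
  qed
  moreover have "card (chords P) = Suc n" "finite (chords P)"
    unfolding C using notin[of ?C] fin IH(2) card_f[of ?C] by simp_all
  moreover have "\<forall>c\<in>chords P. fst c \<le> snd c"
  proof
    fix c assume "c \<in> chords P"
    then consider "c = (s, s)" | d where "d \<in> ?C" "c = ?f d" unfolding C by blast
    then show "fst c \<le> snd c"
    proof cases
      case 2
      then have "fst d \<le> snd d" using le by simp
      then show ?thesis
        using right_end_less_left_end[of s "snd d" "fst d"] unfolding 2 chord_map_def by simp
    qed simp
  qed
  moreover have "int (card {c \<in> chords P. fst c \<le> x} + card {c \<in> chords P. snd c < x}) = x + int (Suc n)"
    if x: "- int (Suc n) \<le> x" "x \<le> int (Suc n)" for x
  proof -
    let ?z = "squeeze_col s x"
    have z: "- int n \<le> ?z" "?z \<le> int n" using x s by (auto simp: squeeze_col_def)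
    have lt: "right_end s b < x \<longleftrightarrow> b < ?z" for b using le_right_end_iff[of x s b] by linarith
    \<comment> \<open>In the two counts together the new chord contributes 0, 1 or 2 for
      \<open>x < s\<close>, \<open>x = s\<close> or \<open>x > s\<close>. Correspondingly
      \<open>?z\<close> is \<open>x + 1\<close>, \<open>x\<close> or \<open>x - 1\<close>, so the
      total is always one more than \<open>x + int n\<close>.\<close>
    have 1: "{c \<in> chords P. fst c \<le> x} = (if s \<le> x then {(s, s)} else {}) \<union> ?f ` {c \<in> ?C. fst c \<le> ?z}"
      unfolding C by (auto simp: chord_map_def left_end_le_iff)
    have 2: "{c \<in> chords P. snd c < x} = (if s < x then {(s, s)} else {}) \<union> ?f ` {c \<in> ?C. snd c < ?z}"
      unfolding C by (auto simp: chord_map_def lt)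
    have "card {c \<in> chords P. fst c \<le> x} = (if s \<le> x then 1 else 0) + card {c \<in> ?C. fst c \<le> ?z}"
      unfolding 1 using notin fin by (simp add: card_f)
    moreover have "card {c \<in> chords P. snd c < x} = (if s < x then 1 else 0) + card {c \<in> ?C. snd c < ?z}"
      unfolding 2 using notin fin by (simp add: card_f)
    moreover have "int (card {c \<in> ?C. fst c \<le> ?z} + card {c \<in> ?C. snd c < ?z}) = ?z + int n"
      using count z by simp
    ultimately show ?thesis by (auto simp: squeeze_col_def)
  qed
  ultimately show ?case by blast
qed

section \<open>Labelings and growth sequences\<close>

text \<open>This is the inverse of a natural labeling. Indexing chords by labels lets the induction
  peel off the largest label.\<close>

definition chord_labeling :: "nat \<Rightarrow> point set \<Rightarrow> (nat \<Rightarrow> int \<times> int) \<Rightarrow> bool" where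
  "chord_labeling n P c \<longleftrightarrow> bij_betw c {1..n} (chords P) \<and>
    (\<forall>i\<in>{1..n}. \<forall>j\<in>{1..n}. chord_le (c i) (c j) \<longrightarrow> i \<le> j)"

definition sites :: "(nat \<Rightarrow> int \<times> int) \<Rightarrow> nat \<Rightarrow> nat" where
  "sites c i = card {j \<in> {1..<i}. fst (c j) < fst (c i)} + card {j \<in> {1..<i}. snd (c j) < fst (c i)}"

lemma attachment_site_eq_sites: "attachment_site P \<sigma> = sites (labeled_chord P \<sigma>)"
  unfolding attachment_site_def sites_def Let_def by (rule ext) simp

lemma chord_le_iff:
  assumes "fst d \<le> snd d"
  shows "chord_le c d \<longleftrightarrow> fst c \<le> fst d \<and> snd d \<le> snd c"
  using assms by (auto simp: chord_le_def)

lemma chord_le_chord_map: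
  assumes "fst d \<le> snd d"
  shows "chord_le (chord_map s c) (chord_map s d) \<longleftrightarrow> chord_le c d"
proof -
  have "fst (chord_map s d) \<le> snd (chord_map s d)"
    using assms right_end_less_left_end[of s "snd d" "fst d"] by (simp add: chord_map_def)
  then show ?thesis
    using chord_le_iff[OF assms] chord_le_iff[of "chord_map s d" "chord_map s c"]
    by (simp add: chord_map_def left_end_mono right_end_mono)
qed

lemma not_chord_le_point:
  assumes "fst d \<le> snd d"
  shows "\<not> chord_le (s, s) (chord_map s d)"
proof
  assume "chord_le (s, s) (chord_map s d)"
  moreover have "fst (chord_map s d) \<le> snd (chord_map s d)"
    using assms right_end_less_left_end[of s "snd d" "fst d"] by (simp add: chord_map_def)
  ultimately show False
    using left_end_neq[of s "fst d"] chord_le_iff[of "chord_map s d" "(s, s)"]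
    by (simp add: chord_map_def)
qed

lemma chords_le:
  assumes "dyck_path n P" "c \<in> chords P"
  shows "fst c \<le> snd c"
  using chords_properties[OF assms(1)] assms(2) by simp

lemma point_notin_chord_map: "(s, s) \<notin> chord_map s ` A"
proof
  assume "(s, s) \<in> chord_map s ` A"
  then obtain c where "(s, s) = chord_map s c" by blast
  then show False using left_end_neq[of s "fst c"] by (simp add: chord_map_def)
qed

text \<open>For the last label all \<open>n\<close> earlier chords are present, and a moved left end
  lies left of \<open>s\<close> iff the original one was at most \<open>s\<close>; the counts are
  therefore those of \<open>chords_properties\<close> at \<open>x = s\<close>. Earlier sites depend
  only on comparisons between ends, which \<open>chord_map s\<close> keeps.\<close>

lemma sites_spread:
  assumes P: "dyck_path n P" and lab: "chord_labeling n P c" and s: "- int n \<le> s" "s \<le> int n"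
    and c': "c' (Suc n) = (s, s)" "\<And>i. i \<in> {1..n} \<Longrightarrow> c' i = chord_map s (c i)"
  shows "int (sites c' (Suc n)) = s + int n" "\<And>i. i \<in> {1..n} \<Longrightarrow> sites c' i = sites c i"
proof -
  have bij: "bij_betw c {1..n} (chords P)" using lab unfolding chord_labeling_def by (rule conjunct1)
  have card_eq: "card {j \<in> {1..n}. Q (c j)} = card {d \<in> chords P. Q d}" for Q
  proof -
    have "bij_betw c {j \<in> {1..n}. Q (c j)} {d \<in> chords P. Q d}"
    proof (rule bij_betw_subset[OF bij])
      show "c ` {j \<in> {1..n}. Q (c j)} = {d \<in> chords P. Q d}"
        unfolding bij_betw_imp_surj_on[OF bij, symmetric] by blast
    qed blast
    then show ?thesis by (rule bij_betw_same_card)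
  qed
  have "{j \<in> {1..<Suc n}. fst (c' j) < fst (c' (Suc n))} = {j \<in> {1..n}. fst (c j) \<le> s}"
    using c' by (auto simp: chord_map_def left_end_less)
  moreover have "{j \<in> {1..<Suc n}. snd (c' j) < fst (c' (Suc n))} = {j \<in> {1..n}. snd (c j) < s}"
    using c' by (auto simp: chord_map_def right_end_less)
  ultimately have "sites c' (Suc n) = card {d \<in> chords P. fst d \<le> s} + card {d \<in> chords P. snd d < s}"
    unfolding sites_def using card_eq[of "\<lambda>d. fst d \<le> s"] card_eq[of "\<lambda>d. snd d < s"] by simp
  then show "int (sites c' (Suc n)) = s + int n" using chords_properties[OF P] s by simp
  fix i assume i: "i \<in> {1..n}"
  have "left_end s a < left_end s b \<longleftrightarrow> a < b" for a b using left_end_mono[of s b a] by linarith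
  then have "{j \<in> {1..<i}. fst (c' j) < fst (c' i)} = {j \<in> {1..<i}. fst (c j) < fst (c i)}"
    "{j \<in> {1..<i}. snd (c' j) < fst (c' i)} = {j \<in> {1..<i}. snd (c j) < fst (c i)}"
    using c'(2) i by (auto simp: chord_map_def right_end_less_left_end)
  then show "sites c' i = sites c i" unfolding sites_def by simp
qed

text \<open>The new chord is a single point and no moved chord lies above it, so it may receive the
  largest label.\<close>

lemma chord_labeling_extend:
  assumes P: "dyck_path n P" and lab: "chord_labeling n P c" and s: "- int n \<le> s" "s \<le> int n"
    and c': "c' (Suc n) = (s, s)" "\<And>i. i \<in> {1..n} \<Longrightarrow> c' i = chord_map s (c i)"
  shows "chord_labeling (Suc n) (spread s P) c'"
proof -
  have bij: "bij_betw c {1..n} (chords P)" using lab unfolding chord_labeling_def by (rule conjunct1)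
  have "bij_betw (chord_map s \<circ> c) {1..n} (chord_map s ` chords P)"
    using bij inj_on_subset[OF inj_chord_map, of "chords P" s]
    by (intro bij_betw_trans[OF bij]) (simp add: bij_betw_def)
  then have "bij_betw c' {1..n} (chord_map s ` chords P)"
    using bij_betw_cong[of "{1..n}" c' "chord_map s \<circ> c"] c'(2) by simp
  then have "bij_betw c' ({1..n} \<union> {Suc n}) (chord_map s ` chords P \<union> {c' (Suc n)})"
    using point_notin_chord_map[of s "chords P"] by (intro notIn_Un_bij_betw) (simp_all add: c'(1))
  moreover have "{1..n} \<union> {Suc n} = {1..Suc n}" by auto
  ultimately have "bij_betw c' {1..Suc n} (chords (spread s P))"
    unfolding chords_spread[OF P s] c'(1) by simp
  moreover have "i \<le> j" if ij: "i \<in> {1..Suc n}" "j \<in> {1..Suc n}" "chord_le (c' i) (c' j)" for i j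
  proof -
    have le: "fst (c j) \<le> snd (c j)" if "j \<in> {1..n}"
      using chords_le[OF P] bij_betwE[OF bij] that by blast
    consider "j = Suc n" | "j \<in> {1..n}" "i = Suc n" | "j \<in> {1..n}" "i \<in> {1..n}" using ij by force
    then show ?thesis
    proof cases
      case 2
      then show ?thesis using ij(3) not_chord_le_point[OF le[OF 2(1)]] c' by simp
    next
      case 3
      then have "chord_le (c i) (c j)" using ij(3) c'(2) chord_le_chord_map[OF le] by simp
      then show ?thesis using lab 3 unfolding chord_labeling_def by blast
    qed (use ij in simp)
  qed
  ultimately show ?thesis unfolding chord_labeling_def by blast
qed

lemma chord_labeling_Suc:
  assumes P: "dyck_path (Suc n) P" and lab: "chord_labeling (Suc n) P c"
  obtains s P' c' where "- int n \<le> s" "s \<le> int n" "dyck_path n P'" "P = spread s P'"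
    "chord_labeling n P' c'" "c (Suc n) = (s, s)" "\<And>i. i \<in> {1..n} \<Longrightarrow> c i = chord_map s (c' i)"
proof -
  have bij: "bij_betw c {1..Suc n} (chords P)"
    and ord: "\<And>i j. i \<in> {1..Suc n} \<Longrightarrow> j \<in> {1..Suc n} \<Longrightarrow> chord_le (c i) (c j) \<Longrightarrow> i \<le> j"
    using lab unfolding chord_labeling_def by blast+
  obtain l r where lr: "c (Suc n) = (l, r)" by fastforce
  have "(l, r) \<in> chords P" using bij_betwE[OF bij] lr by (metis atLeastAtMost_iff le_refl Suc_le_mono le0 One_nat_def)
  then obtain s where s: "l \<le> s" "s \<le> r" "(s, s) \<in> chords P" using chord_above_point[OF P] by blast
  obtain j where j: "j \<in> {1..Suc n}" "c j = (s, s)"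
    using s(3) bij_betw_imp_surj_on[OF bij] by (metis imageE)
  have "chord_le (c (Suc n)) (c j)" unfolding lr j using s by (simp add: chord_le_def)
  then have "Suc n \<le> j" using ord[of "Suc n" j] j(1) by simp
  then have cs: "c (Suc n) = (s, s)" using j by simp
  obtain P' where sb: "- int n \<le> s" "s \<le> int n" and P': "dyck_path n P'" and PP: "P = spread s P'"
    using point_chord_spread[OF P s(3)] .
  have C: "chords P = insert (s, s) (chord_map s ` chords P')"
    unfolding PP by (rule chords_spread[OF P' sb])
  define c' where "c' = inv_into (chords P') (chord_map s) \<circ> c"
  have inj: "inj_on (chord_map s) (chords P')" by (rule inj_on_subset[OF inj_chord_map]) simp
  have "c ` {1..n} = chord_map s ` chords P'"
  proof -
    have "{1..n} = {1..Suc n} - {Suc n}" by auto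
    then have "c ` {1..n} = c ` {1..Suc n} - c ` {Suc n}"
      using bij_betw_imp_inj_on[OF bij] by (simp add: inj_on_image_set_diff[of c "{1..Suc n}"])
    also have "\<dots> = chord_map s ` chords P'"
      using bij_betw_imp_surj_on[OF bij] C point_notin_chord_map[of s "chords P'"] cs by auto
    finally show ?thesis .
  qed
  then have bij_n: "bij_betw c {1..n} (chord_map s ` chords P')"
    using inj_on_subset[OF bij_betw_imp_inj_on[OF bij], of "{1..n}"] by (simp add: bij_betw_def)
  then have bij': "bij_betw c' {1..n} (chords P')"
    unfolding c'_def using bij_betw_inv_into[OF inj_on_imp_bij_betw[OF inj]] by (rule bij_betw_trans)
  have cc': "c i = chord_map s (c' i)" if "i \<in> {1..n}" for i
    unfolding c'_def comp_def using bij_betwE[OF bij_n] that by (simp add: f_inv_into_f)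
  have "chord_labeling n P' c'"
    unfolding chord_labeling_def
  proof (intro conjI ballI impI bij')
    fix i j assume ij: "i \<in> {1..n}" "j \<in> {1..n}" "chord_le (c' i) (c' j)"
    have "fst (c' j) \<le> snd (c' j)" using chords_le[OF P'] bij_betwE[OF bij'] ij(2) by blast
    then have "chord_le (c i) (c j)" using ij cc' chord_le_chord_map by simp
    then show "i \<le> j" using ord[of i j] ij by simp
  qed
  then show ?thesis using that sb P' PP cs cc' by blast
qed

section \<open>Iterated growth along a labeling\<close>

primrec grow_seq :: "(tiling \<Rightarrow> int \<Rightarrow> tiling) \<Rightarrow> (nat \<Rightarrow> nat) \<Rightarrow> nat \<Rightarrow> tiling" where
  "grow_seq g p 0 = empty_tiling"
| "grow_seq g p (Suc n) = g (grow_seq g p n) (int (p (Suc n)) - int n)"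

lemma DTS_seq_eq: "DTS_seq p n = grow_seq strip_grow p n"
  and DTR_seq_eq: "DTR_seq p n = grow_seq ribbon_grow p n"
  by (induction n) simp_all

lemma grow_seq_cong:
  assumes "\<And>i. i \<in> {1..n} \<Longrightarrow> p i = q i"
  shows "grow_seq g p n = grow_seq g q n"
  using assms by (induction n) auto

lemma ci_tilings_0: "ci_tilings 0 = {empty_tiling}"
proof -
  have "skew_boxes {(0, 0)} {(0, 0)} = {}" by (auto simp: skew_boxes_def)
  then show ?thesis
    unfolding ci_tilings_def dyck_tiling_def dyck_path_0
    by (auto simp: empty_tiling_def partition_on_empty weakly_above_def cover_inclusive_def)
qed

context growth
begin

lemma grow_seq_sites_Suc:
  assumes "dyck_path n P" "chord_labeling n P c" "- int n \<le> s" "s \<le> int n"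
    "c' (Suc n) = (s, s)" "\<And>i. i \<in> {1..n} \<Longrightarrow> c' i = chord_map s (c i)"
  shows "grow_seq grow (sites c') (Suc n) = grow (grow_seq grow (sites c) n) s"
proof -
  have "grow_seq grow (sites c') n = grow_seq grow (sites c) n"
    using sites_spread(2)[OF assms] by (intro grow_seq_cong) blast
  then show ?thesis using sites_spread(1)[OF assms] by simp
qed

lemma grow_seq_ci_tilings:
  assumes "dyck_path n P" "chord_labeling n P c"
  shows "grow_seq grow (sites c) n \<in> ci_tilings n \<and> lower (grow_seq grow (sites c) n) = P"
  using assms
proof (induction n arbitrary: P c)
  case 0
  then show ?case by (simp add: ci_tilings_0 dyck_path_0) (simp add: empty_tiling_def)
next
  case (Suc n)
  obtain s P' c' where *: "- int n \<le> s" "s \<le> int n" "dyck_path n P'" "P = spread s P'"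
    "chord_labeling n P' c'" "c (Suc n) = (s, s)" "\<And>i. i \<in> {1..n} \<Longrightarrow> c i = chord_map s (c' i)"
    using chord_labeling_Suc[OF Suc.prems] by metis
  have eq: "grow_seq grow (sites c) (Suc n) = grow (grow_seq grow (sites c') n) s"
    by (rule grow_seq_sites_Suc[OF *(3,5,1,2,6,7)])
  show ?case unfolding eq using Suc.IH[OF *(3,5)] grow_ci_tilings(1,2)[OF _ *(1,2)] *(4) by simp
qed

text \<open>Two independent paths are allowed, so that the induction need not compare the smaller
  paths obtained by undoing the last spread.\<close>

lemma grow_seq_inject:
  assumes "dyck_path n P" "chord_labeling n P c" "dyck_path n Q" "chord_labeling n Q d"
    "grow_seq grow (sites c) n = grow_seq grow (sites d) n"
  shows "\<forall>i\<in>{1..n}. c i = d i"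
  using assms
proof (induction n arbitrary: P c Q d)
  case (Suc n)
  obtain s P' c' where c: "- int n \<le> s" "s \<le> int n" "dyck_path n P'" "P = spread s P'"
    "chord_labeling n P' c'" "c (Suc n) = (s, s)" "\<And>i. i \<in> {1..n} \<Longrightarrow> c i = chord_map s (c' i)"
    using chord_labeling_Suc[OF Suc.prems(1,2)] by metis
  obtain t Q' d' where d: "- int n \<le> t" "t \<le> int n" "dyck_path n Q'" "Q = spread t Q'"
    "chord_labeling n Q' d'" "d (Suc n) = (t, t)" "\<And>i. i \<in> {1..n} \<Longrightarrow> d i = chord_map t (d' i)"
    using chord_labeling_Suc[OF Suc.prems(3,4)] by metis
  have "grow (grow_seq grow (sites c') n) s = grow (grow_seq grow (sites d') n) t"
    using Suc.prems(5) grow_seq_sites_Suc[OF c(3,5,1,2,6,7)] grow_seq_sites_Suc[OF d(3,5,1,2,6,7)] by simp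
  then have eq: "grow_seq grow (sites c') n = grow_seq grow (sites d') n" "s = t"
    using grow_inject grow_seq_ci_tilings c(1,2,3,5) d(1,2,3,5) by blast+
  have "\<forall>i\<in>{1..n}. c' i = d' i" by (rule Suc.IH[OF c(3,5) d(3,5) eq(1)])
  then have "c i = d i" if "i \<in> {1..n}" for i using c(7) d(7) eq(2) that by simp
  moreover have "c (Suc n) = d (Suc n)" using c(6) d(6) eq(2) by simp
  ultimately show ?case by (simp add: atLeastAtMostSuc_conv)
qed simp

lemma grow_seq_surj:
  assumes "T \<in> ci_tilings n"
  shows "\<exists>c. chord_labeling n (lower T) c \<and> grow_seq grow (sites c) n = T"
  using assms
proof (induction n arbitrary: T)
  case 0
  then show ?case
    by (intro exI[of _ "\<lambda>_. (0, 0)"])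
      (simp add: ci_tilings_0 chord_labeling_def empty_tiling_def chords_origin bij_betw_def)
next
  case (Suc n)
  obtain T' s where T': "T' \<in> ci_tilings n" and s: "- int n \<le> s" "s \<le> int n" and T: "T = grow T' s"
    using grow_surj[OF Suc.prems] .
  obtain c where c: "chord_labeling n (lower T') c" "grow_seq grow (sites c) n = T'"
    using Suc.IH[OF T'] by blast
  have P: "dyck_path n (lower T')" using T' by (simp add: ci_tilings_def dyck_tiling_def)
  define c' where "c' i = (if i = Suc n then (s, s) else chord_map s (c i))" for i
  have c': "c' (Suc n) = (s, s)" "\<And>i. i \<in> {1..n} \<Longrightarrow> c' i = chord_map s (c i)"
    by (auto simp: c'_def)
  have "chord_labeling (Suc n) (lower T) c'"
    unfolding T grow_ci_tilings(2)[OF T' s] by (rule chord_labeling_extend[OF P c(1) s c'])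
  moreover have "grow_seq grow (sites c') (Suc n) = T"
    using grow_seq_sites_Suc[OF P c(1) s c'] c(2) T by simp
  ultimately show ?case by blast
qed

end

section \<open>Linear extensions and chord labelings\<close>

lemma bij_betw_L0:
  assumes "dyck_path n P"
  shows "bij_betw (L0 P) (chords P) {1..n}"
proof -
  have fin: "finite (chords P)" and card: "card (chords P) = n" and inj: "inj_on fst (chords P)"
    using chords_properties[OF assms] by simp_all
  have less: "L0 P c < L0 P d" if "c \<in> chords P" "d \<in> chords P" "fst c < fst d" for c d
    unfolding L0_def
  proof (rule psubset_card_mono)
    have "d \<in> {e \<in> chords P. fst e \<le> fst d}" "d \<notin> {e \<in> chords P. fst e \<le> fst c}" using that by auto
    moreover have "{e \<in> chords P. fst e \<le> fst c} \<subseteq> {e \<in> chords P. fst e \<le> fst d}" using that by auto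
    ultimately show "{e \<in> chords P. fst e \<le> fst c} \<subset> {e \<in> chords P. fst e \<le> fst d}" by blast
  qed (use fin in simp)
  have inj_L0: "inj_on (L0 P) (chords P)"
  proof (rule inj_onI)
    fix c d assume cd: "c \<in> chords P" "d \<in> chords P" "L0 P c = L0 P d"
    then have "fst c = fst d" using less[of c d] less[of d c] by (metis less_irrefl linorder_cases)
    then show "c = d" using inj cd by (simp add: inj_on_eq_iff)
  qed
  have "L0 P ` chords P \<subseteq> {1..n}"
  proof
    fix i assume "i \<in> L0 P ` chords P"
    then obtain c where c: "c \<in> chords P" "i = L0 P c" by blast
    have "card {c} \<le> L0 P c" unfolding L0_def using fin c(1) by (intro card_mono) auto
    moreover have "L0 P c \<le> n" unfolding L0_def card[symmetric] using fin by (intro card_mono) auto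
    ultimately show "i \<in> {1..n}" using c(2) by simp
  qed
  moreover have "card (L0 P ` chords P) = card {1..n}" using card_image[OF inj_L0] card by simp
  ultimately have "L0 P ` chords P = {1..n}" by (intro card_subset_eq) auto
  then show ?thesis using inj_L0 by (simp add: bij_betw_def)
qed

text \<open>With \<open>\<sigma>\<close> given by \<open>L0\<close> after the inverse of
  \<open>L\<close>, applying the inverse of \<open>L0\<close> leaves the inverse of
  \<open>L\<close>, a chord labeling.\<close>

lemma labeled_chord_labeling:
  assumes P: "dyck_path n P" and \<sigma>: "\<sigma> \<in> linear_extensions n P"
  shows "chord_labeling n P (labeled_chord P \<sigma>)"
proof -
  obtain L where L: "bij_betw L (chords P) {1..n}"
    and ord: "\<And>c d. c \<in> chords P \<Longrightarrow> d \<in> chords P \<Longrightarrow> chord_le c d \<Longrightarrow> L c \<le> L d"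
    and sig: "\<And>i. i \<in> {1..n} \<Longrightarrow> \<sigma> i = L0 P (inv_into (chords P) L i)"
    using \<sigma> unfolding linear_extensions_def natural_labeling_def by blast
  let ?c = "inv_into (chords P) L"
  have bij: "bij_betw ?c {1..n} (chords P)" by (rule bij_betw_inv_into[OF L])
  have eq: "labeled_chord P \<sigma> i = ?c i" if "i \<in> {1..n}" for i
    unfolding labeled_chord_def sig[OF that]
    by (rule inv_into_f_f[OF bij_betw_imp_inj_on[OF bij_betw_L0[OF P]]]) (use bij_betwE[OF bij] that in blast)
  have "bij_betw (labeled_chord P \<sigma>) {1..n} (chords P)"
    using bij bij_betw_cong[of "{1..n}" "labeled_chord P \<sigma>" ?c] eq by simp
  moreover have "i \<le> j" if "i \<in> {1..n}" "j \<in> {1..n}" "chord_le (labeled_chord P \<sigma> i) (labeled_chord P \<sigma> j)" for i j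
  proof -
    have "?c i \<in> chords P" "?c j \<in> chords P" using bij_betwE[OF bij] that by blast+
    then have "L (?c i) \<le> L (?c j)" using ord that eq by simp
    then show ?thesis using bij_betw_inv_into_right[OF L] that by simp
  qed
  ultimately show ?thesis unfolding chord_labeling_def by blast
qed

lemma ex_linear_extension:
  assumes P: "dyck_path n P" and lab: "chord_labeling n P c"
  obtains \<sigma> where "\<sigma> \<in> linear_extensions n P" "\<And>i. i \<in> {1..n} \<Longrightarrow> labeled_chord P \<sigma> i = c i"
proof -
  have bij: "bij_betw c {1..n} (chords P)"
    and ord: "\<And>i j. i \<in> {1..n} \<Longrightarrow> j \<in> {1..n} \<Longrightarrow> chord_le (c i) (c j) \<Longrightarrow> i \<le> j"
    using lab unfolding chord_labeling_def by blast+
  note L0 = bij_betw_L0[OF P]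
  define \<sigma> where "\<sigma> i = (if i \<in> {1..n} then L0 P (c i) else i)" for i
  let ?L = "inv_into {1..n} c"
  have L: "bij_betw ?L (chords P) {1..n}" by (rule bij_betw_inv_into[OF bij])
  have "bij_betw (L0 P \<circ> c) {1..n} {1..n}" by (rule bij_betw_trans[OF bij L0])
  then have "bij_betw \<sigma> {1..n} {1..n}"
    using bij_betw_cong[of "{1..n}" \<sigma> "L0 P \<circ> c"] by (simp add: \<sigma>_def)
  then have "\<sigma> permutes {1..n}" by (rule bij_imp_permutes) (auto simp: \<sigma>_def)
  moreover have "natural_labeling n P ?L"
    unfolding natural_labeling_def
  proof (intro conjI ballI impI L)
    fix d e assume de: "d \<in> chords P" "e \<in> chords P" "chord_le d e"
    have range: "?L d \<in> {1..n}" "?L e \<in> {1..n}" using bij_betwE[OF L] de by blast+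
    have "chord_le (c (?L d)) (c (?L e))"
      unfolding bij_betw_inv_into_right[OF bij de(1)] bij_betw_inv_into_right[OF bij de(2)] by (fact de(3))
    then show "?L d \<le> ?L e" by (rule ord[OF range])
  qed
  moreover have "\<sigma> i = L0 P (inv_into (chords P) ?L i)" if i: "i \<in> {1..n}" for i
  proof -
    have "c i \<in> chords P" "?L (c i) = i"
      using bij_betwE[OF bij] bij_betw_inv_into_left[OF bij] i by blast+
    then have "inv_into (chords P) ?L i = c i"
      using bij_betw_imp_inj_on[OF L] by (metis inv_into_f_f)
    then show ?thesis using i by (simp add: \<sigma>_def)
  qed
  ultimately have "\<sigma> \<in> linear_extensions n P" unfolding linear_extensions_def by blast
  moreover have "labeled_chord P \<sigma> i = c i" if "i \<in> {1..n}" for i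
    unfolding labeled_chord_def \<sigma>_def
    using that inv_into_f_f[OF bij_betw_imp_inj_on[OF L0]] bij_betwE[OF bij] by simp
  ultimately show ?thesis using that by blast
qed

lemma linear_extension_eqI:
  assumes P: "dyck_path n P" and \<sigma>: "\<sigma> \<in> linear_extensions n P" and \<tau>: "\<tau> \<in> linear_extensions n P"
    and eq: "\<And>i. i \<in> {1..n} \<Longrightarrow> labeled_chord P \<sigma> i = labeled_chord P \<tau> i"
  shows "\<sigma> = \<tau>"
proof
  fix i
  have perm: "\<sigma> permutes {1..n}" "\<tau> permutes {1..n}" using \<sigma> \<tau> by (simp_all add: linear_extensions_def)
  show "\<sigma> i = \<tau> i"
  proof (cases "i \<in> {1..n}")
    case True
    have "L0 P (labeled_chord P \<rho> i) = \<rho> i" if "\<rho> permutes {1..n}" for \<rho>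
      unfolding labeled_chord_def
      by (rule bij_betw_inv_into_right[OF bij_betw_L0[OF P]]) (use that True in \<open>simp only: permutes_in_image\<close>)
    then show ?thesis using perm eq[OF True] by metis
  next
    case False
    then show ?thesis using perm by (simp add: permutes_not_in)
  qed
qed

lemma (in growth) bij_betw_grow_seq:
  assumes P: "dyck_path n P"
  shows "bij_betw (\<lambda>\<sigma>. grow_seq grow (attachment_site P \<sigma>) n)
    (linear_extensions n P) (cover_inclusive_tilings n P)"
  unfolding attachment_site_eq_sites
proof (rule bij_betw_imageI)
  let ?F = "\<lambda>\<sigma>. grow_seq grow (sites (labeled_chord P \<sigma>)) n"
  show "inj_on ?F (linear_extensions n P)"
  proof (rule inj_onI)
    fix \<sigma> \<tau> assume st: "\<sigma> \<in> linear_extensions n P" "\<tau> \<in> linear_extensions n P" "?F \<sigma> = ?F \<tau>"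
    have "\<forall>i\<in>{1..n}. labeled_chord P \<sigma> i = labeled_chord P \<tau> i"
      by (rule grow_seq_inject[OF P labeled_chord_labeling[OF P st(1)] P labeled_chord_labeling[OF P st(2)] st(3)])
    then show "\<sigma> = \<tau>" using linear_extension_eqI[OF P st(1,2)] by blast
  qed
  have ci: "T \<in> cover_inclusive_tilings n P \<longleftrightarrow> T \<in> ci_tilings n \<and> lower T = P" for T
    by (auto simp: cover_inclusive_tilings_def ci_tilings_def)
  show "?F ` linear_extensions n P = cover_inclusive_tilings n P"
  proof
    show "?F ` linear_extensions n P \<subseteq> cover_inclusive_tilings n P"
      using grow_seq_ci_tilings[OF P labeled_chord_labeling[OF P]] unfolding ci image_subset_iff by blast
    show "cover_inclusive_tilings n P \<subseteq> ?F ` linear_extensions n P"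
    proof
      fix T assume "T \<in> cover_inclusive_tilings n P"
      then have T: "T \<in> ci_tilings n" "lower T = P" unfolding ci by auto
      obtain c where c: "chord_labeling n P c" "grow_seq grow (sites c) n = T"
        using grow_seq_surj[OF T(1)] T(2) by blast
      obtain \<sigma> where \<sigma>: "\<sigma> \<in> linear_extensions n P" "\<And>i. i \<in> {1..n} \<Longrightarrow> labeled_chord P \<sigma> i = c i"
        using ex_linear_extension[OF P c(1)] by blast
      \<comment> \<open>The labelings agree only on \<open>{1..n}\<close>, which suffices because
        the site of \<open>i\<close> refers to labels up to \<open>i\<close> alone.\<close>
      have "sites (labeled_chord P \<sigma>) i = sites c i" if i: "i \<in> {1..n}" for i
      proof -
        have "labeled_chord P \<sigma> j = c j" if "j \<in> {1..<i}" for j using that i \<sigma>(2)[of j] by simp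
        then have "{j \<in> {1..<i}. Q (labeled_chord P \<sigma> j)} = {j \<in> {1..<i}. Q (c j)}" for Q by auto
        from this[of "\<lambda>d. fst d < fst (c i)"] this[of "\<lambda>d. snd d < fst (c i)"]
        show ?thesis unfolding sites_def \<sigma>(2)[OF i] by simp
      qed
      then have "?F \<sigma> = T" using c(2) grow_seq_cong by metis
      then show "T \<in> ?F ` linear_extensions n P" using \<sigma>(1) by blast
    qed
  qed
qed

theorem theorem4:
  fixes n :: nat and lam :: "point set"
  assumes "dyck_path n lam"
  shows "bij_betw (DTS n lam) (linear_extensions n lam) (cover_inclusive_tilings n lam) \<and>
         bij_betw (DTR n lam) (linear_extensions n lam) (cover_inclusive_tilings n lam)"
proof -
  have "DTS n lam = (\<lambda>\<sigma>. grow_seq strip_grow (attachment_site lam \<sigma>) n)"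
    "DTR n lam = (\<lambda>\<sigma>. grow_seq ribbon_grow (attachment_site lam \<sigma>) n)"
    by (simp_all add: fun_eq_iff DTS_def DTR_def DTS_seq_eq DTR_seq_eq)
  then show ?thesis
    using strip.bij_betw_grow_seq[OF assms] ribbon.bij_betw_grow_seq[OF assms] by simp
qed

end
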